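(* Fix an integer $k\ge2$. Let $\theta_0=(\pi_0,\mu_0,t_0)\in\Theta_k$ satisfy (a) $\min_j(\pi_0)_j>0$ and (b) $(\mu_{0j},t_{0j})\neq(\mu_{0\ell},t_{0\ell})$ for all $j\ne\ell$. Let $X_1,X_2,\dots$ be i.i.d. from the Gaussian mixture density $f_{\theta_0}$, let $\ell_n(\theta)=\sum_{i=1}^n\log f_\theta(X_i)$, and for $\lambda_n>0$ let $$\ell_n^{\mathrm{pen}}(\theta):=\ell_n(\theta)-n\lambda_n g(\theta),\qquad g(\theta):=\sum_{j=1}^k(\mu_j^2+t_j^2).$$ (i) (Existence) For every $n$ and every $\lambda_n>0$, $\ell_n^{\mathrm{pen}}$ attains its maximum over $\Theta_k$. (ii) (Vanishing-penalty orbit consistency) Suppose $\lambda_n\downarrow0$ and $n\lambda_n\to\infty$. Let $\widehat\Theta_n^{\mathrm{pen}}:=\arg\max_{\theta\in\Theta_k}\ell_n^{\mathrm{pen}}(\theta)$. Then $$d_H^{d_{\mathfrak S_k}}\big(\widehat\Theta_n^{\mathrm{pen}},[\theta_0]\big)\to0\quad\text{in probability.}$$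
   Context: For $\theta=(\pi,\mu,t)$ in $\Theta_k=\Delta_{k-1}\times\mathbb{R}^k\times\mathbb{R}^k$, with $\Delta_{k-1}=\{\pi\in[0,1]^k:\sum_j\pi_j=1\}$ and $\sigma_j=e^{t_j}$ (so $t_j=\log\sigma_j$), the $k$-component Gaussian mixture density is $f_\theta(x)=\sum_{j=1}^k\pi_j\varphi(x;\mu_j,\sigma_j)$, where $\varphi(x;\mu,\sigma)=\frac{1}{\sqrt{2\pi}\,\sigma}\exp(-\frac{(x-\mu)^2}{2\sigma^2})$. The symmetric group $\mathfrak S_k$ acts by simultaneously permuting the coordinates of $\pi,\mu,t$; $[\theta]=\{\tau\cdot\theta:\tau\in\mathfrak S_k\}$; $d_{\mathfrak S_k}(\theta,\theta')=\min_{\tau\in\mathfrak S_k}\|\theta-\tau\cdot\theta'\|_2$ in the coordinates $(\pi,\mu,t)$. $d_H^{d_{\mathfrak S_k}}(A,B)=\max\{\sup_{a\in A}\inf_{b\in B}d_{\mathfrak S_k}(a,b),\ \sup_{b\in B}\inf_{a\in A}d_{\mathfrak S_k}(a,b)\}$ for nonempty $A,B$. *)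

theory Defs
  imports "HOL-Probability.Probability"
begin

text \<open>
  A parameter is a triple \<open>(p, \<mu>, t)\<close> of weights, means and log standard deviations, indexed by a
  finite type with \<open>k\<close> elements. The norm on the nested product type is the Euclidean norm of the
  \<open>3k\<close> coordinates.
\<close>

type_synonym 'k param = "(real ^ 'k) \<times> (real ^ 'k) \<times> (real ^ 'k)"

definition Theta :: "'k::finite param set" where
  "Theta = {(p, \<mu>, t). (\<forall>j. p $ j \<in> {0..1}) \<and> (\<Sum>j\<in>UNIV. p $ j) = 1}"

definition mix_density :: "'k::finite param \<Rightarrow> real \<Rightarrow> real" where
  "mix_density = (\<lambda>(p, \<mu>, t) x. \<Sum>j\<in>UNIV. p $ j * normal_density (\<mu> $ j) (exp (t $ j)) x)"

definition perm_vec :: "('k \<Rightarrow> 'k) \<Rightarrow> real ^ 'k \<Rightarrow> real ^ ('k::finite)" where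
  "perm_vec \<tau> v = (\<chi> j. v $ inv \<tau> j)"

definition perm_act :: "('k \<Rightarrow> 'k) \<Rightarrow> 'k param \<Rightarrow> ('k::finite) param" where
  "perm_act \<tau> = (\<lambda>(p, \<mu>, t). (perm_vec \<tau> p, perm_vec \<tau> \<mu>, perm_vec \<tau> t))"

definition orbit_of :: "'k::finite param \<Rightarrow> 'k param set" where
  "orbit_of \<theta> = {perm_act \<tau> \<theta> | \<tau>. \<tau> permutes UNIV}"

definition orbit_dist :: "'k::finite param \<Rightarrow> 'k param \<Rightarrow> real" where
  "orbit_dist \<theta> \<theta>' = Min {norm (\<theta> - perm_act \<tau> \<theta>') | \<tau>. \<tau> permutes UNIV}"

text \<open>
  Values are in \<^typ>\<open>ennreal\<close>, so that the suprema are meaningful for unbounded sets as well. The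
  definition is intended for nonnegative \<open>d\<close> and nonempty sets.
\<close>

definition hausdorff_dist :: "('a \<Rightarrow> 'a \<Rightarrow> real) \<Rightarrow> 'a set \<Rightarrow> 'a set \<Rightarrow> ennreal" where
  "hausdorff_dist d A B =
     max (SUP a\<in>A. INF b\<in>B. ennreal (d a b)) (SUP b\<in>B. INF a\<in>A. ennreal (d a b))"

definition log_lik :: "(nat \<Rightarrow> real) \<Rightarrow> nat \<Rightarrow> 'k::finite param \<Rightarrow> real" where
  "log_lik x n \<theta> = (\<Sum>i<n. ln (mix_density \<theta> (x i)))"

definition penalty :: "'k::finite param \<Rightarrow> real" where
  "penalty = (\<lambda>(p, \<mu>, t). \<Sum>j\<in>UNIV. (\<mu> $ j)\<^sup>2 + (t $ j)\<^sup>2)"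

definition pen_log_lik :: "(nat \<Rightarrow> real) \<Rightarrow> nat \<Rightarrow> real \<Rightarrow> 'k::finite param \<Rightarrow> real" where
  "pen_log_lik x n lam \<theta> = log_lik x n \<theta> - real n * lam * penalty \<theta>"

definition pen_argmax :: "(nat \<Rightarrow> real) \<Rightarrow> nat \<Rightarrow> real \<Rightarrow> 'k::finite param set" where
  "pen_argmax x n lam = {\<theta>. is_arg_max (pen_log_lik x n lam) (\<lambda>\<theta>. \<theta> \<in> Theta) \<theta>}"

text \<open>
  Measurability is part of the definition: \<^const>\<open>measure\<close> is \<open>0\<close> on non-measurable sets, so the limit
  alone would not say anything about a non-measurable sequence.
\<close>

definition tendsto_zero_in_prob :: "'a measure \<Rightarrow> (nat \<Rightarrow> 'a \<Rightarrow> ennreal) \<Rightarrow> bool" where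
  "tendsto_zero_in_prob M Y \<longleftrightarrow>
     (\<forall>n. Y n \<in> borel_measurable M) \<and>
     (\<forall>\<epsilon>>0. (\<lambda>n. measure M {\<omega> \<in> space M. Y n \<omega> > ennreal \<epsilon>}) \<longlonglongrightarrow> 0)"

end

(*
Existence: ln f_theta grows at most linearly in t while the penalty is quadratic.

Consistency is Wald's argument on the compactification of the parameter space by m -> tanh m and
t -> tanh t. If theta is at least as good as theta_0, concavity of ln gives
(1/n) sum ln ((f_theta + f_0) / (2 f_0)) (X_i) >= (lambda_n / 2) (g(theta) - g(theta_0)).
At a limit point outside the orbit, let F be the sum of the components that stay finite. It is a
subprobability mixture different from f_0 by identifiability, so E ln ((F + f_0) / (2 f_0)) < 0 by
Gibbs, and the weak law carries this over to a neighbourhood, apart from the components with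
t -> -infinity. Such a narrow component contributes at most (1/n) sum ln (1 + phi / f_0) (X_i).
Since few pairs of observations are close, at all scales simultaneously, its window of width
exp (t/2) contains at most 1 + n exp ((t+1)/8) observations, each contributing about |t|. The second
term is small for very negative t, and the single observation, worth |t|/n, is paid for by half
of the penalty lambda_n t^2 because n lambda_n tends to infinity. A finite subcover concludes.
*)
theory Submission
  imports Defs "HOL-Real_Asymp.Real_Asymp"
begin

section \<open>Gaussian densities and identifiability\<close>

text \<open>The unpenalized likelihood is unbounded along components that shrink onto an
  observation, and since \<open>lam n\<close> tends to 0 the penalty does not confine the maximizers
  to a fixed compact set. Narrow components must therefore be controlled for all means and all
  widths at once. Two devices make this possible. Averaging f_theta with f_0 keeps the main
  logarithm above ln (1/2) and lets each narrow component split off as a separate summand. Counting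
  close pairs bounds the number of observations in a window without reference to its centre. The
  exponents come from one chain: a component of standard deviation s is negligible beyond distance
  sqrt s; two observations are that close with probability of order sqrt s; Markov's inequality with
  threshold n^2 s^(1/4) fails with probability of order s^(1/4), which is summable over s = exp
  (-m); and passing from pairs to points takes a square root, leaving n s^(1/8). Convergence in
  probability also includes measurability of the distance to a random set of maximizers, which is
  obtained from countable dense subsets instead of a measurable selection.\<close>

abbreviation gauss :: "real \<Rightarrow> real \<Rightarrow> real \<Rightarrow> real" where
  "gauss m t \<equiv> normal_density m (exp t)"

lemma gauss_eq:
  "gauss m t x = exp (-t) / sqrt (2 * pi) * exp (- (x - m)\<^sup>2 / (2 * exp (2 * t)))"
proof -
  have "sqrt (2 * pi * (exp t)\<^sup>2) = sqrt (2 * pi) * exp t"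
    by (simp add: real_sqrt_mult)
  moreover have "(exp t)\<^sup>2 = exp (2 * t)"
    by (simp add: exp_double)
  ultimately show ?thesis
    by (simp add: normal_density_def exp_minus field_simps)
qed

lemma gauss_pos: "gauss m t x > 0"
  by (simp add: normal_density_pos)

text \<open>The prefactor is largest at the lower end of the range of \<open>t\<close>, the
  exponential factor at the upper end. Bounding the two separately gives one function that dominates
  all these densities, which is what a neighbourhood of parameters requires.\<close>

lemma gauss_le_envelope:
  assumes "s \<le> t" "t \<le> s'" "0 \<le> d" "d \<le> \<bar>x - m\<bar>"
  shows "gauss m t x \<le> exp (-s) / sqrt (2 * pi) * exp (- d\<^sup>2 / (2 * exp (2 * s')))"
proof -
  have "d\<^sup>2 \<le> (x - m)\<^sup>2"
    using assms(3,4) by (metis abs_le_square_iff abs_of_nonneg)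
  then have "d\<^sup>2 / (2 * exp (2 * s')) \<le> (x - m)\<^sup>2 / (2 * exp (2 * t))"
    using assms(2) by (intro frac_le) auto
  then show ?thesis
    unfolding gauss_eq using assms(1) by (intro mult_mono divide_right_mono) auto
qed

lemma gauss_le: "s \<le> t \<Longrightarrow> gauss m t x \<le> exp (-s)"
proof -
  assume "s \<le> t"
  then have "gauss m t x \<le> exp (-s) / sqrt (2 * pi)"
    using gauss_le_envelope[of s t t 0 x m] by simp
  also have "\<dots> \<le> exp (-s) / 1"
    using pi_gt3 by (intro divide_left_mono) auto
  finally show ?thesis by simp
qed

text \<open>At distance \<open>exp (t / 2)\<close>, the square root of the standard deviation, the
  Gaussian exponent is already \<open>u = exp (-t) / 2\<close>. The density is then at most 2 u /
  exp u, and exp u \<ge> u^2 / 2 turns this into 4 / u, which is the origin of the constant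
  8.\<close>

lemma gauss_le_far:
  assumes "exp (t / 2) \<le> \<bar>x - m\<bar>"
  shows "gauss m t x \<le> 8 * exp t"
proof -
  define u where "u = exp (-t) / 2"
  have u: "u > 0" by (simp add: u_def)
  have "(exp (t / 2))\<^sup>2 / (2 * exp (2 * t)) = u"
    by (simp add: u_def exp_double[symmetric] exp_diff[symmetric] exp_minus field_simps flip: exp_add)
  then have "gauss m t x \<le> exp (-t) / sqrt (2 * pi) * exp (- u)"
    using gauss_le_envelope[of t t t "exp (t/2)" x m] assms by simp
  also have "\<dots> \<le> exp (-t) / 1 * exp (- u)"
    using pi_gt3 by (intro mult_right_mono divide_left_mono) auto
  also have "\<dots> = 2 * u / exp u"
    by (simp add: u_def exp_minus field_simps)
  also have "\<dots> \<le> 2 * u / (u\<^sup>2 / 2)"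
    using exp_lower_Taylor_quadratic[of u] u by (intro divide_left_mono) auto
  also have "\<dots> = 8 * exp t"
    using u by (simp add: u_def power2_eq_square exp_minus field_simps)
  finally show ?thesis .
qed

text \<open>Right tails are ordered lexicographically, by standard deviation and then by mean: the
  exponent of the ratio is a quadratic with negative leading coefficient or, for equal deviations, a
  linear function with negative slope.\<close>

lemma gauss_ratio_tendsto_0:
  assumes "s < t \<or> s = t \<and> m < m'"
  shows "((\<lambda>x. gauss m s x / gauss m' t x) \<longlongrightarrow> 0) at_top"
proof -
  define a b where "a = 1 / (2 * exp (2 * t))" and "b = 1 / (2 * exp (2 * s))"
  have ab: "a > 0" "b > 0" by (auto simp: a_def b_def)
  have eq: "gauss m s x / gauss m' t x = exp (t - s) * exp (a * (x - m')\<^sup>2 - b * (x - m)\<^sup>2)" for x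
  proof -
    have "gauss m s x = exp (-s) / sqrt (2 * pi) * exp (- (b * (x - m)\<^sup>2))"
      "gauss m' t x = exp (-t) / sqrt (2 * pi) * exp (- (a * (x - m')\<^sup>2))"
      by (simp_all add: gauss_eq a_def b_def)
    then show ?thesis
      by (simp only:) (simp add: exp_diff exp_minus divide_simps)
  qed
  have "filterlim (\<lambda>x. a * (x - m')\<^sup>2 - b * (x - m)\<^sup>2) at_bot at_top"
  proof (cases "s < t")
    case True
    then have "a - b < 0" by (auto simp: a_def b_def field_simps)
    moreover have "a * (x - m')\<^sup>2 - b * (x - m)\<^sup>2
        = (a - b) * x\<^sup>2 + (2 * b * m - 2 * a * m') * x + (a * m'\<^sup>2 - b * m\<^sup>2)" for x
      by (simp add: algebra_simps power2_eq_square)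
    moreover have "filterlim (\<lambda>x. A * x\<^sup>2 + B * x + C) at_bot at_top" if "A < 0" for A B C :: real
      using that by real_asymp
    ultimately show ?thesis by simp
  next
    case False
    then have *: "a = b" "m < m'" using assms by (auto simp: a_def b_def)
    have "a * (x - m')\<^sup>2 - b * (x - m)\<^sup>2 = (2 * a * (m - m')) * x + (a * (m'\<^sup>2 - m\<^sup>2))" for x
      by (simp add: algebra_simps power2_eq_square *)
    moreover have "2 * a * (m - m') < 0" using * ab by (simp add: mult_pos_neg)
    moreover have "filterlim (\<lambda>x. A * x + B) at_bot at_top" if "A < 0" for A B :: real
      using that by real_asymp
    ultimately show ?thesis by simp
  qed
  then have "((\<lambda>x. exp (a * (x - m')\<^sup>2 - b * (x - m)\<^sup>2)) \<longlongrightarrow> 0) at_top"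
    by (rule filterlim_compose[OF exp_at_bot])
  then show ?thesis
    unfolding eq by (rule tendsto_mult_right_zero)
qed

text \<open>Dividing by the density with the heaviest right tail and letting x tend to infinity
  leaves only its own coefficient, which must vanish. Removing that component gives an induction on
  the number of components.\<close>

lemma gauss_independent:
  fixes I :: "(real \<times> real) set"
  assumes "finite I" "\<And>x. (\<Sum>(m, t)\<in>I. c (m, t) * gauss m t x) = 0" "i \<in> I"
  shows "c i = 0"
  using assms
proof (induction "card I" arbitrary: I i rule: less_induct)
  case less
  define T where "T = Max (snd ` I)"
  define m0 where "m0 = Max (fst ` {p \<in> I. snd p = T})"
  have "T \<in> snd ` I"
    unfolding T_def using less.prems by (intro Max_in) auto
  then have ne: "{p \<in> I. snd p = T} \<noteq> {}" by auto
  have "m0 \<in> fst ` {p \<in> I. snd p = T}"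
    unfolding m0_def using less.prems ne by (intro Max_in) auto
  then have mem: "(m0, T) \<in> I" by auto
  have lex: "snd p < T \<or> snd p = T \<and> fst p < m0" if "p \<in> I" "p \<noteq> (m0, T)" for p
  proof -
    have "snd p \<le> T" unfolding T_def using less.prems that by (intro Max_ge) auto
    moreover have "fst p \<le> m0" if "snd p = T"
      unfolding m0_def using less.prems \<open>p \<in> I\<close> that by (intro Max_ge) auto
    ultimately show ?thesis using that(2) by (cases p) force
  qed
  have sum0: "(\<Sum>p\<in>I. c p * gauss (fst p) (snd p) x) = 0" for x
    using less.prems(2)[of x] by (simp add: case_prod_beta)
  have "(\<Sum>p\<in>I - {(m0, T)}. c p * (gauss (fst p) (snd p) x / gauss m0 T x)) = - c (m0, T)" for x
  proof -
    have "(\<Sum>p\<in>I. c p * (gauss (fst p) (snd p) x / gauss m0 T x)) = 0"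
      using sum0[of x] by (simp flip: sum_divide_distrib)
    moreover have "gauss m0 T x \<noteq> 0" using gauss_pos[of m0 T x] by simp
    ultimately show ?thesis
      using less.prems(1) mem by (simp add: sum.remove)
  qed
  moreover have "((\<lambda>x. \<Sum>p\<in>I - {(m0, T)}. c p * (gauss (fst p) (snd p) x / gauss m0 T x))
      \<longlongrightarrow> (\<Sum>p\<in>I - {(m0, T)}. c p * 0)) at_top"
    by (intro tendsto_sum tendsto_mult tendsto_const gauss_ratio_tendsto_0) (use lex in auto)
  ultimately have c0: "c (m0, T) = 0"
    using tendsto_unique[OF trivial_limit_at_top_linorder]
    by (simp add: tendsto_const_iff)
  show ?case
  proof (cases "i = (m0, T)")
    case True
    then show ?thesis using c0 by simp
  next
    case False
    have "(\<Sum>(m, t)\<in>I - {(m0, T)}. c (m, t) * gauss m t x) = 0" for x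
      using less.prems(2)[of x] sum.remove[OF less.prems(1) mem, of "\<lambda>(m, t). c (m, t) * gauss m t x"] c0
      by simp
    moreover have "card (I - {(m0, T)}) < card I"
      using mem less.prems(1) by (intro psubset_card_mono) auto
    ultimately show ?thesis
      using less.hyps[of "I - {(m0, T)}" i] less.prems False by auto
  qed
qed

text \<open>The left side runs over an index set \<open>S\<close> because only the components whose
  parameters stay finite survive at a limit point. By independence every component of the true
  mixture needs a partner in \<open>S\<close>, and partners of different components differ. As many
  partners as indices exhaust all indices, so no component can have been lost.\<close>

lemma gauss_mixture_identifiable:
  fixes p0 m0 t0 p m t :: "real ^ 'k::finite"
  assumes eq: "\<And>x. (\<Sum>j\<in>S. p $ j * gauss (m $ j) (t $ j) x)
      = (\<Sum>j\<in>UNIV. p0 $ j * gauss (m0 $ j) (t0 $ j) x)"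
    and pos: "\<And>j. p0 $ j > 0"
    and distinct: "\<And>j l. j \<noteq> l \<Longrightarrow> (m0 $ j, t0 $ j) \<noteq> (m0 $ l, t0 $ l)"
  shows "S = UNIV \<and> (\<exists>\<tau>. \<tau> permutes UNIV \<and> perm_act \<tau> (p0, m0, t0) = (p, m, t))"
proof -
  define P where "P = (\<lambda>j. (m $ j, t $ j))"
  define Q where "Q = (\<lambda>j. (m0 $ j, t0 $ j))"
  \<comment> \<open>The net coefficient of the density with parameters \<open>i\<close>, after
    collecting on each side all indices that share these parameters.\<close>
  define w where "w = (\<lambda>i. (\<Sum>j\<in>{j\<in>S. P j = i}. p $ j) - (\<Sum>j\<in>{j. Q j = i}. p0 $ j))"
  define I where "I = range P \<union> range Q"
  have finI: "finite I" by (simp add: I_def)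
  have injQ: "inj Q" using distinct unfolding Q_def inj_def by metis
  have w0: "w i = 0" if "i \<in> I" for i
  proof (rule gauss_independent[OF finI _ that])
    fix x
    have 1: "(\<Sum>i\<in>I. (\<Sum>j\<in>{j\<in>S. P j = i}. p $ j) * gauss (fst i) (snd i) x)
        = (\<Sum>j\<in>S. p $ j * gauss (m $ j) (t $ j) x)"
    proof -
      have "(\<Sum>j\<in>S. p $ j * gauss (m $ j) (t $ j) x)
          = (\<Sum>i\<in>I. \<Sum>j\<in>{j\<in>S. P j = i}. p $ j * gauss (m $ j) (t $ j) x)"
        by (rule sum.group[symmetric]) (auto simp: finI I_def)
      then show ?thesis
        by (auto simp: sum_distrib_right P_def intro!: sum.cong)
    qed
    have 2: "(\<Sum>i\<in>I. (\<Sum>j\<in>{j. Q j = i}. p0 $ j) * gauss (fst i) (snd i) x)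
        = (\<Sum>j\<in>UNIV. p0 $ j * gauss (m0 $ j) (t0 $ j) x)"
    proof -
      have "(\<Sum>j\<in>UNIV. p0 $ j * gauss (m0 $ j) (t0 $ j) x)
          = (\<Sum>i\<in>I. \<Sum>j\<in>{j\<in>UNIV. Q j = i}. p0 $ j * gauss (m0 $ j) (t0 $ j) x)"
        by (rule sum.group[symmetric]) (auto simp: finI I_def)
      then show ?thesis
        by (auto simp: sum_distrib_right Q_def intro!: sum.cong)
    qed
    show "(\<Sum>(m, t)\<in>I. w (m, t) * gauss m t x) = 0"
      using 1 2 eq[of x] by (simp add: w_def case_prod_beta left_diff_distrib sum_subtractf)
  qed
  have Q1: "{j. Q j = Q l} = {l}" for l using injQ by (auto simp: inj_def)
  have wl: "(\<Sum>j\<in>{j\<in>S. P j = Q l}. p $ j) = p0 $ l" for l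
    using w0[of "Q l"] by (simp add: w_def I_def Q1)
  have "\<exists>j. j \<in> S \<and> P j = Q l" for l
  proof (rule ccontr)
    assume "\<nexists>j. j \<in> S \<and> P j = Q l"
    then have *: "{j\<in>S. P j = Q l} = {}" by auto
    show False using wl[of l] pos[of l] unfolding * by simp
  qed
  then obtain s where s: "\<And>l. s l \<in> S" "\<And>l. P (s l) = Q l" by metis
  have "inj s" using s(2) injQ by (metis injD injI)
  then have bij: "bij s" by (simp add: bij_def finite_UNIV_inj_surj)
  then have S: "S = UNIV" using s(1) by (metis UNIV_eq_I bij_pointE)
  have inv: "s (inv s j) = j" "inv s (s j) = j" for j
    using bij by (auto simp: bij_def surj_f_inv_f)
  have "{j\<in>S. P j = Q l} = {s l}" for l
  proof -
    have "j = s l" if "P j = Q l" for j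
      using that s(2)[of "inv s j"] inv injQ by (metis injD)
    then show ?thesis using s by auto
  qed
  then have ps: "p $ (s l) = p0 $ l" for l using wl[of l] by simp
  \<comment> \<open>\<open>perm_act\<close> permutes by the inverse, so coordinate
    \<open>s l\<close> of the image is coordinate \<open>l\<close> of the true parameter; this is
    the direction in which \<open>s\<close> was chosen.\<close>
  have "perm_act s (p0, m0, t0) = (p, m, t)"
    using s(2) ps inv by (auto simp: perm_act_def perm_vec_def vec_eq_iff P_def Q_def; metis)
  moreover have "s permutes UNIV" using bij by (simp add: permutes_def bij_iff)
  ultimately show ?thesis using S by blast
qed

section \<open>Parameter orbits, existence and measurability of maximizers\<close>

lemma mix_density_eq:
  "mix_density (p, m, t) x = (\<Sum>j\<in>UNIV. p $ j * gauss (m $ j) (t $ j) x)"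
  by (simp add: mix_density_def)

lemma mix_density_pos:
  assumes "\<theta> \<in> Theta"
  shows "mix_density \<theta> x > 0"
proof -
  obtain p m t where \<theta>: "\<theta> = (p, m, t)" by (cases \<theta>)
  have p: "\<And>j. p $ j \<ge> 0" "(\<Sum>j\<in>UNIV. p $ j) = 1"
    using assms by (auto simp: Theta_def \<theta>)
  then obtain j where "p $ j \<noteq> 0"
    by (metis sum.neutral zero_neq_one)
  then have "p $ j > 0" using p(1)[of j] by simp
  then show ?thesis
    unfolding \<theta> mix_density_eq using p(1)
    by (intro sum_pos2[of _ j]) (auto intro!: mult_pos_pos gauss_pos)
qed

lemma mix_density_measurable [measurable]: "mix_density \<theta> \<in> borel_measurable borel"
  unfolding mix_density_def by (cases \<theta>) simp

section \<open>Action of the symmetric group and distance to an orbit\<close>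

lemma finite_perms: "finite {\<tau> :: 'k::finite \<Rightarrow> 'k. \<tau> permutes UNIV}"
  by (rule finite_permutations) simp

lemma perm_act_comp:
  assumes "\<tau> permutes UNIV" "\<sigma> permutes UNIV"
  shows "perm_act \<tau> (perm_act \<sigma> \<theta>) = perm_act (\<tau> \<circ> \<sigma>) \<theta>"
proof -
  have "inv (\<tau> \<circ> \<sigma>) = inv \<sigma> \<circ> inv \<tau>"
    using assms by (simp add: o_inv_distrib permutes_bij)
  then show ?thesis
    by (cases \<theta>) (simp add: perm_act_def perm_vec_def)
qed

lemma orbit_dist_le:
  "\<tau> permutes UNIV \<Longrightarrow> orbit_dist \<theta> \<theta>' \<le> norm (\<theta> - perm_act \<tau> \<theta>')"
  unfolding orbit_dist_def by (rule Min_le) (auto simp: finite_perms)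

lemma orbit_dist_gt_iff:
  "c < orbit_dist \<theta> \<theta>' \<longleftrightarrow> (\<forall>\<tau>. \<tau> permutes UNIV \<longrightarrow> c < norm (\<theta> - perm_act \<tau> \<theta>'))"
proof -
  have "{norm (\<theta> - perm_act \<tau> \<theta>') | \<tau>. \<tau> permutes UNIV} \<noteq> {}"
    using permutes_id by blast
  then show ?thesis
    unfolding orbit_dist_def by (subst Min_gr_iff) (auto simp: finite_perms)
qed

lemma open_orbit_dist_gt: "open {\<theta> :: 'k::finite param. c < orbit_dist \<theta> \<theta>'}"
proof -
  have "{\<theta> :: 'k param. c < orbit_dist \<theta> \<theta>'}
      = (\<Inter>\<tau>\<in>{\<tau>. \<tau> permutes UNIV}. {\<theta>. c < norm (\<theta> - perm_act \<tau> \<theta>')})"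
    by (auto simp: orbit_dist_gt_iff)
  moreover have "open \<dots>"
    by (intro open_INT finite_perms ballI open_Collect_less continuous_intros)
  ultimately show ?thesis by simp
qed

text \<open>The minimum runs over the whole group, so moving the second argument along its orbit
  only reindexes it by a right translation.\<close>

lemma orbit_dist_orbit:
  assumes "\<theta>' \<in> orbit_of \<theta>0"
  shows "orbit_dist \<theta> \<theta>' = orbit_dist \<theta> \<theta>0"
proof -
  obtain \<sigma> where \<sigma>: "\<sigma> permutes UNIV" "\<theta>' = perm_act \<sigma> \<theta>0"
    using assms by (auto simp: orbit_of_def)
  have "{norm (\<theta> - perm_act \<tau> \<theta>') | \<tau>. \<tau> permutes UNIV}
      = {norm (\<theta> - perm_act \<tau> \<theta>0) | \<tau>. \<tau> permutes UNIV}"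
  proof (intro set_eqI iffI; clarify)
    fix \<tau> :: "'a \<Rightarrow> 'a" assume "\<tau> permutes UNIV"
    then show "\<exists>\<tau>'. norm (\<theta> - perm_act \<tau> \<theta>') = norm (\<theta> - perm_act \<tau>' \<theta>0) \<and> \<tau>' permutes UNIV"
      using \<sigma> by (metis perm_act_comp permutes_compose)
  next
    fix \<tau> :: "'a \<Rightarrow> 'a" assume \<tau>: "\<tau> permutes UNIV"
    have *: "\<tau> \<circ> inv \<sigma> permutes UNIV"
      using \<tau> \<sigma> by (intro permutes_compose permutes_inv)
    have "perm_act (\<tau> \<circ> inv \<sigma>) \<theta>' = perm_act (\<tau> \<circ> (inv \<sigma> \<circ> \<sigma>)) \<theta>0"
      unfolding \<sigma>(2) perm_act_comp[OF * \<sigma>(1)] by (simp add: comp_assoc)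
    also have "inv \<sigma> \<circ> \<sigma> = id"
      using \<sigma>(1) by (simp add: permutes_inv_o)
    finally have "perm_act \<tau> \<theta>0 = perm_act (\<tau> \<circ> inv \<sigma>) \<theta>'"
      by (simp only: comp_id)
    with * show "\<exists>\<tau>'. norm (\<theta> - perm_act \<tau> \<theta>0) = norm (\<theta> - perm_act \<tau>' \<theta>') \<and> \<tau>' permutes UNIV"
      by (intro exI[of _ "\<tau> \<circ> inv \<sigma>"] conjI) (simp_all only:)
  qed
  then show ?thesis by (simp add: orbit_dist_def)
qed

text \<open>Since \<open>orbit_dist\<close> is constant along the orbit in its second argument, the
  two directed distances are the supremum and the infimum of the same function over
  \<open>A\<close>, and for nonempty \<open>A\<close> the supremum wins.\<close>

lemma hausdorff_dist_orbit:
  assumes "A \<noteq> {}"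
  shows "hausdorff_dist orbit_dist A (orbit_of \<theta>0) = (SUP a\<in>A. ennreal (orbit_dist a \<theta>0))"
proof -
  have ne: "orbit_of \<theta>0 \<noteq> {}"
    unfolding orbit_of_def using permutes_id by blast
  have 1: "(INF b\<in>orbit_of \<theta>0. ennreal (orbit_dist a b)) = ennreal (orbit_dist a \<theta>0)" for a
    using ne by (simp add: orbit_dist_orbit cong: INF_cong)
  have 2: "(SUP b\<in>orbit_of \<theta>0. INF a\<in>A. ennreal (orbit_dist a b)) = (INF a\<in>A. ennreal (orbit_dist a \<theta>0))"
    using ne by (simp add: orbit_dist_orbit cong: SUP_cong)
  show ?thesis
    unfolding hausdorff_dist_def 1 2 by (rule max_absorb1) (rule INF_le_SUP[OF assms])
qed

section \<open>Coercivity and existence of penalized maximizers\<close>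

lemma closed_Theta: "closed (Theta :: 'k::finite param set)"
proof -
  have "Theta = (\<Inter>j. {\<theta> :: 'k param. 0 \<le> fst \<theta> $ j}) \<inter> (\<Inter>j. {\<theta>. fst \<theta> $ j \<le> 1})
      \<inter> {\<theta>. (\<Sum>j\<in>UNIV. fst \<theta> $ j) = 1}"
    by (auto simp: Theta_def)
  moreover have "closed \<dots>"
    by (intro closed_Int closed_INT ballI closed_Collect_le closed_Collect_eq continuous_intros)
  ultimately show ?thesis by simp
qed

lemma Theta_nonempty: "(Theta :: 'k::finite param set) \<noteq> {}"
proof -
  obtain j0 :: 'k where True by blast
  have "((\<chi> j. if j = j0 then 1 else 0), 0, 0) \<in> (Theta :: 'k param set)"
    by (auto simp: Theta_def)
  then show ?thesis by blast
qed

lemma continuous_on_mix_density: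
  "continuous_on S (\<lambda>\<theta> :: 'k::finite param. mix_density \<theta> x)"
  unfolding mix_density_def case_prod_beta normal_density_def
  by (intro continuous_intros) auto

lemma penalty_eq: "penalty (p, m, t) = (norm m)\<^sup>2 + (norm t)\<^sup>2"
  by (simp add: penalty_def norm_vec_def L2_set_def sum.distrib sum_nonneg)

lemma continuous_on_pen_log_lik:
  "continuous_on Theta (pen_log_lik x n lam :: 'k::finite param \<Rightarrow> real)"
  unfolding pen_log_lik_def log_lik_def penalty_def case_prod_beta
  by (intro continuous_intros continuous_on_mix_density)
     (simp add: less_imp_neq[OF mix_density_pos, symmetric])

lemma mix_density_le_exp_norm:
  assumes "(p, m, t) \<in> Theta"
  shows "mix_density (p, m, t) x \<le> exp (norm t)"
proof -
  have p: "\<And>j. p $ j \<ge> 0" "(\<Sum>j\<in>UNIV. p $ j) = 1"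
    using assms by (auto simp: Theta_def)
  have "gauss (m $ j) (t $ j) x \<le> exp (norm t)" for j
  proof -
    have "- (t $ j) \<le> norm t"
      using component_le_norm_cart[of t j] by linarith
    then show ?thesis
      using gauss_le[of "t $ j" "t $ j" "m $ j" x] by (smt (verit) exp_le_cancel_iff)
  qed
  then have "mix_density (p, m, t) x \<le> (\<Sum>j\<in>UNIV. p $ j * exp (norm t))"
    unfolding mix_density_eq using p(1) by (intro sum_mono mult_left_mono) auto
  also have "\<dots> = exp (norm t)"
    using p(2) by (simp flip: sum_distrib_right)
  finally show ?thesis .
qed

lemma pen_log_lik_le:
  assumes "(p, m, t) \<in> Theta"
  shows "pen_log_lik x n lam (p, m, t) \<le> n * norm t - n * lam * ((norm m)\<^sup>2 + (norm t)\<^sup>2)"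
proof -
  have "ln (mix_density (p, m, t) (x i)) \<le> norm t" for i
    using mix_density_le_exp_norm[OF assms] mix_density_pos[OF assms] ln_le_cancel_iff
    by (metis exp_gt_zero ln_exp)
  then have "log_lik x n (p, m, t) \<le> (\<Sum>i<n. norm t)"
    unfolding log_lik_def by (intro sum_mono)
  then show ?thesis by (simp add: pen_log_lik_def penalty_eq)
qed

lemma pen_log_lik_arg_max_exists:
  assumes "lam > 0"
  shows "\<exists>\<theta> :: 'k::finite param. is_arg_max (pen_log_lik x n lam) (\<lambda>\<theta>. \<theta> \<in> Theta) \<theta>"
proof (cases "n = 0")
  \<comment> \<open>Without observations the penalty is multiplied by 0 as well. There is no
    coercivity, but the criterion vanishes identically and every point of \<open>Theta\<close> is a
    maximizer.\<close>
  case True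
  then show ?thesis
    using Theta_nonempty by (auto simp: is_arg_max_def pen_log_lik_def log_lik_def)
next
  case False
  obtain \<theta>1 :: "'k param" where \<theta>1: "\<theta>1 \<in> Theta" using Theta_nonempty by auto
  define c where "c = pen_log_lik x n lam \<theta>1"
  define L where "L = {\<theta> \<in> Theta :: 'k param set. c \<le> pen_log_lik x n lam \<theta>}"
  define N where "N = real n * lam"
  have N: "N > 0" using False assms by (simp add: N_def)
  \<comment> \<open>Completing the square gives n r \<le> n^2 / (2 N) + (N / 2) r^2, so half of the
    penalty absorbs the linear growth of the likelihood. The other half bounds the penalty on the
    superlevel set of \<theta>1 by \<open>B\<close>.\<close>
  define B where "B = 2 / N * ((real n)\<^sup>2 / (2 * N) - c)"
  have bound: "norm \<theta> \<le> real CARD('k) + 2 * (B + 1)" if L: "\<theta> \<in> L" for \<theta>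
  proof -
    obtain p m t where \<theta>: "\<theta> = (p, m, t)" by (cases \<theta>)
    define u where "u = (norm m)\<^sup>2 + (norm t)\<^sup>2"
    have "c \<le> n * norm t - N * u"
      using pen_log_lik_le[of p m t x n lam] L unfolding L_def \<theta> N_def u_def by simp
    moreover have "n * norm t \<le> (real n)\<^sup>2 / (2 * N) + N / 2 * (norm t)\<^sup>2"
    proof -
      have "0 \<le> (n - N * norm t)\<^sup>2 / (2 * N)" using N by simp
      also have "\<dots> = (real n)\<^sup>2 / (2 * N) + N / 2 * (norm t)\<^sup>2 - n * norm t"
        using N by (simp add: field_simps power2_eq_square)
      finally show ?thesis by simp
    qed
    moreover have "N / 2 * (norm t)\<^sup>2 \<le> N / 2 * u"
      using N by (simp add: u_def)
    ultimately have "N / 2 * u \<le> (real n)\<^sup>2 / (2 * N) - c" by linarith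
    then have uB: "u \<le> B" using N by (simp add: B_def field_simps)
    have sq: "r \<le> r\<^sup>2 + 1" for r :: real
      using zero_le_power2[of "r - 1/2"] by (simp add: power2_eq_square algebra_simps)
    have "norm m \<le> B + 1" "norm t \<le> B + 1"
      using uB sq[of "norm m"] sq[of "norm t"] zero_le_power2[of "norm m"] zero_le_power2[of "norm t"]
      unfolding u_def by linarith+
    moreover have "norm p \<le> real CARD('k)"
    proof -
      have "norm p \<le> (\<Sum>j\<in>UNIV. \<bar>p $ j\<bar>)" by (rule norm_le_l1_cart)
      also have "\<dots> \<le> (\<Sum>j\<in>(UNIV::'k set). 1)"
        using L by (intro sum_mono) (auto simp: L_def \<theta> Theta_def)
      finally show ?thesis by simp
    qed
    moreover have "norm \<theta> \<le> norm p + (norm m + norm t)"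
      unfolding \<theta> using norm_Pair_le[of p "(m, t)"] norm_Pair_le[of m t] by linarith
    ultimately have "norm \<theta> \<le> real CARD('k) + ((B + 1) + (B + 1))"
      by (meson add_mono order_trans)
    then show ?thesis by simp
  qed
  have "bounded L" using bound by (rule boundedI)
  moreover have "closed L"
  proof -
    have "L = Theta \<inter> pen_log_lik x n lam -` {c..}" by (auto simp: L_def)
    then show ?thesis
      using continuous_closed_preimage[OF continuous_on_pen_log_lik closed_Theta closed_atLeast] by metis
  qed
  ultimately have "compact L" by (simp add: compact_eq_bounded_closed)
  moreover have \<theta>1L: "\<theta>1 \<in> L" using \<theta>1 by (simp add: L_def c_def)
  moreover have "continuous_on L (pen_log_lik x n lam)"
    by (rule continuous_on_subset[OF continuous_on_pen_log_lik]) (auto simp: L_def)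
  ultimately obtain \<theta> where \<theta>: "\<theta> \<in> L" "\<And>\<theta>'. \<theta>' \<in> L \<Longrightarrow> pen_log_lik x n lam \<theta>' \<le> pen_log_lik x n lam \<theta>"
    using continuous_attains_sup[of L "pen_log_lik x n lam"] by blast
  have "pen_log_lik x n lam \<theta>' \<le> pen_log_lik x n lam \<theta>" if "\<theta>' \<in> Theta" for \<theta>' :: "'k param"
    using that \<theta>(2)[OF \<theta>1L] \<theta>(2)[of \<theta>'] by (cases "\<theta>' \<in> L") (auto simp: L_def c_def)
  then have "is_arg_max (pen_log_lik x n lam) (\<lambda>\<theta>. \<theta> \<in> Theta) \<theta>"
    using \<theta>(1) by (auto simp: is_arg_max_def L_def not_less)
  then show ?thesis ..
qed

text \<open>For compact C, the maximum over C reaches the supremum over S iff for every point q of a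
  countable dense subset of S and every tolerance, some point of a countable dense subset of C comes
  within the tolerance of the value at q. The tolerance is there because the maximizing point itself
  may be missed by the dense subset. The open set \<open>D\<close> is then a countable union of
  compact sets.\<close>

lemma measurable_exists_maximizer:
  fixes h :: "'a \<Rightarrow> 'b::euclidean_space \<Rightarrow> real"
  assumes cont: "\<And>\<omega>. \<omega> \<in> space M \<Longrightarrow> continuous_on S (h \<omega>)"
    and meas: "\<And>\<theta>. \<theta> \<in> S \<Longrightarrow> (\<lambda>\<omega>. h \<omega> \<theta>) \<in> borel_measurable M"
    and S: "closed S" and D: "open D"
  shows "{\<omega> \<in> space M. \<exists>\<theta>\<in>S \<inter> D. \<forall>\<theta>'\<in>S. h \<omega> \<theta>' \<le> h \<omega> \<theta>} \<in> sets M"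
proof -
  obtain Q where Q: "countable Q" "Q \<subseteq> S" "S \<subseteq> closure Q"
    using separable by metis
  have clQ: "closure Q = S"
    using Q S by (simp add: closure_minimal subset_antisym)
  have compact_case: "{\<omega> \<in> space M. \<exists>\<theta>\<in>C. \<forall>\<theta>'\<in>S. h \<omega> \<theta>' \<le> h \<omega> \<theta>} \<in> sets M"
    if C: "compact C" "C \<subseteq> S" for C
  proof (cases "C = {}")
    case False
    obtain R where R: "countable R" "R \<subseteq> C" "C \<subseteq> closure R"
      using separable by metis
    have clR: "closure R = C"
      using R C by (simp add: closure_minimal compact_imp_closed subset_antisym)
    have "{\<omega> \<in> space M. \<exists>\<theta>\<in>C. \<forall>\<theta>'\<in>S. h \<omega> \<theta>' \<le> h \<omega> \<theta>}
        = {\<omega> \<in> space M. \<forall>q\<in>Q. \<forall>j::nat. \<exists>r\<in>R. h \<omega> q - 1 / Suc j < h \<omega> r}" (is "?A = ?B")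
    proof (intro set_eqI iffI; clarify)
      fix \<omega> \<theta> q and j :: nat
      assume *: "\<omega> \<in> space M" "\<theta> \<in> C" "\<forall>\<theta>'\<in>S. h \<omega> \<theta>' \<le> h \<omega> \<theta>" "q \<in> Q"
      have contC: "continuous_on (closure R) (h \<omega>)"
        unfolding clR using cont[OF *(1)] C(2) continuous_on_subset by blast
      show "\<exists>r\<in>R. h \<omega> q - 1 / Suc j < h \<omega> r"
      proof (rule ccontr)
        assume "\<not> ?thesis"
        then have "h \<omega> \<theta> \<le> h \<omega> q - 1 / Suc j"
          using continuous_le_on_closure[OF contC, of \<theta> "h \<omega> q - 1 / Suc j"] *(2) clR
          by (auto simp: not_less)
        moreover have "h \<omega> q \<le> h \<omega> \<theta>" using * Q by auto
        moreover have "1 / real (Suc j) > 0" by simp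
        ultimately show False by linarith
      qed
    next
      fix \<omega> assume \<omega>: "\<omega> \<in> space M" and *: "\<forall>q\<in>Q. \<forall>j::nat. \<exists>r\<in>R. h \<omega> q - 1 / Suc j < h \<omega> r"
      have "continuous_on C (h \<omega>)" using cont[OF \<omega>] C(2) continuous_on_subset by blast
      then obtain \<theta> where \<theta>: "\<theta> \<in> C" "\<And>r. r \<in> C \<Longrightarrow> h \<omega> r \<le> h \<omega> \<theta>"
        using continuous_attains_sup[OF C(1) False] by blast
      have "h \<omega> q \<le> h \<omega> \<theta>" if q: "q \<in> Q" for q
      proof (rule field_le_epsilon)
        fix e :: real assume "e > 0"
        then obtain j where j: "1 / Suc j < e" by (rule nat_approx_posE)
        obtain r where "r \<in> R" "h \<omega> q - 1 / Suc j < h \<omega> r"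
          using bspec[OF * q, THEN spec[of _ j]] by (elim bexE)
        then show "h \<omega> q \<le> h \<omega> \<theta> + e" using \<theta>(2)[of r] R(2) j by auto
      qed
      then have "h \<omega> \<theta>' \<le> h \<omega> \<theta>" if "\<theta>' \<in> S" for \<theta>'
        using continuous_le_on_closure[of Q "h \<omega>" \<theta>' "h \<omega> \<theta>"] cont[OF \<omega>] clQ that by simp
      then show "\<exists>\<theta>\<in>C. \<forall>\<theta>'\<in>S. h \<omega> \<theta>' \<le> h \<omega> \<theta>" using \<theta>(1) by blast
    qed
    also have "?B \<in> sets M"
    proof -
      have [measurable]: "(\<lambda>\<omega>. h \<omega> q) \<in> borel_measurable M" if "q \<in> Q" for q
        using that Q(2) meas by blast
      have [measurable]: "(\<lambda>\<omega>. h \<omega> r) \<in> borel_measurable M" if "r \<in> R" for r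
        using that R(2) C(2) meas by blast
      show ?thesis
        using Q(1) R(1) by measurable
    qed
    finally show ?thesis .
  qed auto
  obtain K :: "nat \<Rightarrow> 'b set" where K: "\<And>n. compact (K n)" "(\<Union>n. K n) = D"
    using open_Union_compact_subsets[OF D] by metis
  have "{\<omega> \<in> space M. \<exists>\<theta>\<in>S \<inter> D. \<forall>\<theta>'\<in>S. h \<omega> \<theta>' \<le> h \<omega> \<theta>}
      = (\<Union>n. {\<omega> \<in> space M. \<exists>\<theta>\<in>S \<inter> K n. \<forall>\<theta>'\<in>S. h \<omega> \<theta>' \<le> h \<omega> \<theta>})"
    using K(2) by blast
  also have "\<dots> \<in> sets M"
    using K(1) S by (intro sets.countable_UN) (auto intro!: compact_case closed_Int_compact)
  finally show ?thesis .
qed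

lemma SUP_ennreal_gt_iff:
  "ennreal c < (SUP a\<in>A. ennreal (f a)) \<longleftrightarrow> (\<exists>a\<in>A. c < f a)" if "c \<ge> 0"
  using that by (auto simp: less_SUP_iff ennreal_less_iff intro: bexI)

text \<open>The distance to the orbit exceeds \<open>c\<close> exactly when some maximizer lies in
  the open set of parameters with \<open>c < orbit_dist\<close>, which is the form that
  \<open>measurable_exists_maximizer\<close> treats.\<close>

lemma hausdorff_argmax_measurable:
  assumes X [measurable]: "\<And>i. X i \<in> borel_measurable M" and lam: "lam > 0"
  shows "(\<lambda>\<omega>. hausdorff_dist orbit_dist (pen_argmax (\<lambda>i. X i \<omega>) n lam)
            (orbit_of (\<theta>0 :: 'k::finite param))) \<in> borel_measurable M"
proof -
  have ne: "pen_argmax x n lam \<noteq> ({} :: 'k param set)" for x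
    using pen_log_lik_arg_max_exists[OF lam] by (auto simp: pen_argmax_def)
  have arg_iff: "(\<exists>\<theta>\<in>pen_argmax x n lam. c < orbit_dist \<theta> \<theta>0) \<longleftrightarrow>
      (\<exists>\<theta>\<in>Theta \<inter> {\<theta>. c < orbit_dist \<theta> \<theta>0}. \<forall>\<theta>'\<in>(Theta :: 'k param set).
        pen_log_lik x n lam \<theta>' \<le> pen_log_lik x n lam \<theta>)" for x c
    unfolding pen_argmax_def is_arg_max_def not_less[symmetric] by blast
  have "{\<omega> \<in> space M. y < (SUP a\<in>pen_argmax (\<lambda>i. X i \<omega>) n lam. ennreal (orbit_dist a \<theta>0))} \<in> sets M" for y
  proof (cases y)
    case (real c)
    have "{\<omega> \<in> space M. y < (SUP a\<in>pen_argmax (\<lambda>i. X i \<omega>) n lam. ennreal (orbit_dist a \<theta>0))}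
        = {\<omega> \<in> space M. \<exists>\<theta>\<in>Theta \<inter> {\<theta>. c < orbit_dist \<theta> \<theta>0}. \<forall>\<theta>'\<in>(Theta :: 'k param set).
            pen_log_lik (\<lambda>i. X i \<omega>) n lam \<theta>' \<le> pen_log_lik (\<lambda>i. X i \<omega>) n lam \<theta>}"
      unfolding real SUP_ennreal_gt_iff[OF real(1)]
      by (simp only: arg_iff)
    moreover have "(\<lambda>\<omega>. pen_log_lik (\<lambda>i. X i \<omega>) n lam \<theta>) \<in> borel_measurable M" for \<theta> :: "'k param"
      unfolding pen_log_lik_def log_lik_def by measurable
    ultimately show ?thesis
      using measurable_exists_maximizer[of M Theta "\<lambda>\<omega>. pen_log_lik (\<lambda>i. X i \<omega>) n lam",
          OF continuous_on_pen_log_lik _ closed_Theta open_orbit_dist_gt[of c \<theta>0]]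
      by simp
  qed simp
  then show ?thesis
    unfolding hausdorff_dist_orbit[OF ne] by (rule borel_measurableI_greater)
qed

section \<open>Asymptotic negligibility and moments of the true density\<close>

lemma (in prob_space) indep_vars_imp_indep_var:
  assumes "indep_vars (\<lambda>_. borel) (X :: nat \<Rightarrow> 'a \<Rightarrow> real) UNIV" "i \<noteq> j"
  shows "indep_var borel (X i) borel (X j)"
proof -
  have "indep_var
      borel ((\<lambda>f. f i) \<circ> (\<lambda>\<omega>. restrict (\<lambda>i. X i \<omega>) {i}))
      borel ((\<lambda>f. f j) \<circ> (\<lambda>\<omega>. restrict (\<lambda>i. X i \<omega>) {j}))"
    using assms by (intro indep_var_compose[OF indep_var_restrict[OF assms(1)]]) auto
  then show ?thesis by (simp add: comp_def)
qed

lemma (in prob_space) weak_law_chebyshev: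
  fixes Z :: "nat \<Rightarrow> 'a \<Rightarrow> real"
  assumes indep: "indep_vars (\<lambda>_. borel) Z UNIV"
    and sq: "\<And>i. integrable M (\<lambda>\<omega>. (Z i \<omega>)\<^sup>2)" "\<And>i. expectation (\<lambda>\<omega>. (Z i \<omega>)\<^sup>2) = v"
    and mean: "\<And>i. expectation (Z i) = 0"
    and n: "n > 0" and e: "e > 0"
  shows "prob {\<omega> \<in> space M. n * e \<le> \<bar>\<Sum>i<n. Z i \<omega>\<bar>} \<le> v / (n * e\<^sup>2)"
proof -
  have rv [measurable]: "random_variable borel (Z i)" for i
    using indep by (simp add: indep_vars_def)
  have int: "integrable M (Z i)" for i
    by (rule square_integrable_imp_integrable[OF rv sq(1)])
  have cross: "integrable M (\<lambda>\<omega>. Z i \<omega> * Z j \<omega>)"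
      "expectation (\<lambda>\<omega>. Z i \<omega> * Z j \<omega>) = (if i = j then v else 0)" for i j
  proof -
    have "integrable M (\<lambda>\<omega>. Z i \<omega> * Z j \<omega>) \<and> expectation (\<lambda>\<omega>. Z i \<omega> * Z j \<omega>) = (if i = j then v else 0)"
    proof (cases "i = j")
      case True
      then show ?thesis using sq by (simp add: power2_eq_square)
    next
      case False
      then have "indep_var borel (Z i) borel (Z j)"
        by (rule indep_vars_imp_indep_var[OF indep])
      then show ?thesis
        using False mean int by (simp add: indep_var_integrable indep_var_lebesgue_integral)
    qed
    then show "integrable M (\<lambda>\<omega>. Z i \<omega> * Z j \<omega>)"
      "expectation (\<lambda>\<omega>. Z i \<omega> * Z j \<omega>) = (if i = j then v else 0)" by auto
  qed
  define S where "S = (\<lambda>\<omega>. \<Sum>i<n. Z i \<omega>)"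
  have [measurable]: "random_variable borel S" unfolding S_def by measurable
  have S2: "(S \<omega>)\<^sup>2 = (\<Sum>i<n. \<Sum>j<n. Z i \<omega> * Z j \<omega>)" for \<omega>
    by (simp add: S_def power2_eq_square sum_product)
  have iS2: "integrable M (\<lambda>\<omega>. (S \<omega>)\<^sup>2)"
    unfolding S2 by (intro Bochner_Integration.integrable_sum cross)
  have "expectation (\<lambda>\<omega>. (S \<omega>)\<^sup>2) = (\<Sum>i<n. \<Sum>j<n. if i = j then v else 0)"
    unfolding S2 by (simp add: Bochner_Integration.integral_sum Bochner_Integration.integrable_sum cross)
  also have "\<dots> = n * v" by simp
  finally have ES2: "expectation (\<lambda>\<omega>. (S \<omega>)\<^sup>2) = n * v" .
  have ES: "expectation S = 0"
    unfolding S_def by (simp add: Bochner_Integration.integral_sum int mean)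
  have "prob {\<omega> \<in> space M. n * e \<le> \<bar>S \<omega> - expectation S\<bar>} \<le> variance S / (n * e)\<^sup>2"
    using n e by (intro Chebyshev_inequality iS2) auto
  then show ?thesis
    unfolding ES using n e by (simp add: ES2) (simp add: S_def power2_eq_square field_simps)
qed

text \<open>This says that the outer probability of \<open>B n\<close> tends to 0. The events to
  which it is applied quantify over uncountably many parameters, and covering them by measurable
  sets avoids proving each of them measurable. The notion passes to subsets and to finite
  unions.\<close>

definition asymp_null :: "'a measure \<Rightarrow> (nat \<Rightarrow> 'a set) \<Rightarrow> bool" where
  "asymp_null M B \<longleftrightarrow>
     (\<forall>\<delta>>0. \<forall>\<^sub>F n in sequentially. \<exists>E\<in>sets M. measure M E \<le> \<delta> \<and> B n \<subseteq> E)"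

lemma asymp_nullD:
  "asymp_null M B \<Longrightarrow> \<delta> > 0 \<Longrightarrow>
    \<forall>\<^sub>F n in sequentially. \<exists>E\<in>sets M. measure M E \<le> \<delta> \<and> B n \<subseteq> E"
  by (simp add: asymp_null_def)

lemma asymp_null_mono:
  assumes "asymp_null M B" "\<forall>\<^sub>F n in sequentially. A n \<subseteq> B n"
  shows "asymp_null M A"
  unfolding asymp_null_def
proof (intro allI impI)
  fix \<delta> :: real assume "\<delta> > 0"
  then have "\<forall>\<^sub>F n in sequentially. \<exists>E\<in>sets M. measure M E \<le> \<delta> \<and> B n \<subseteq> E"
    using assms(1) by (simp add: asymp_null_def)
  with assms(2) show "\<forall>\<^sub>F n in sequentially. \<exists>E\<in>sets M. measure M E \<le> \<delta> \<and> A n \<subseteq> E"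
    by eventually_elim (meson order_trans)
qed

lemma asymp_null_empty: "asymp_null M (\<lambda>_. {})"
  unfolding asymp_null_def by (intro allI impI always_eventually bexI[of _ "{}"]) auto

lemma asymp_null_Un:
  assumes "asymp_null M A" "asymp_null M B"
  shows "asymp_null M (\<lambda>n. A n \<union> B n)"
  unfolding asymp_null_def
proof (intro allI impI)
  fix \<delta> :: real assume "\<delta> > 0"
  then have "\<forall>\<^sub>F n in sequentially. \<exists>E\<in>sets M. measure M E \<le> \<delta> / 2 \<and> A n \<subseteq> E"
      "\<forall>\<^sub>F n in sequentially. \<exists>E\<in>sets M. measure M E \<le> \<delta> / 2 \<and> B n \<subseteq> E"
    by (intro asymp_nullD assms; simp)+
  then show "\<forall>\<^sub>F n in sequentially. \<exists>E\<in>sets M. measure M E \<le> \<delta> \<and> A n \<union> B n \<subseteq> E"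
  proof eventually_elim
    case (elim n)
    then obtain E F where EF: "E \<in> sets M" "F \<in> sets M" "measure M E \<le> \<delta> / 2" "measure M F \<le> \<delta> / 2"
      "A n \<subseteq> E" "B n \<subseteq> F" by blast
    have "measure M (E \<union> F) \<le> measure M E + measure M F"
      using EF by (intro measure_Un_le)
    with EF show ?case by (intro bexI[of _ "E \<union> F"]) auto
  qed
qed

lemma asymp_null_UN:
  assumes "finite I" "\<And>i. i \<in> I \<Longrightarrow> asymp_null M (B i)"
  shows "asymp_null M (\<lambda>n. \<Union>i\<in>I. B i n)"
  using assms by (induction I rule: finite_induct) (simp_all add: asymp_null_empty asymp_null_Un)

lemma asymp_nullI_tendsto:
  assumes "\<And>n. B n \<in> sets M" "(\<lambda>n. measure M (B n)) \<longlonglongrightarrow> 0"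
  shows "asymp_null M B"
  unfolding asymp_null_def
proof (intro allI impI)
  fix \<delta> :: real assume "\<delta> > 0"
  then have "\<forall>\<^sub>F n in sequentially. measure M (B n) < \<delta>"
    by (rule order_tendstoD(2)[OF assms(2)])
  then show "\<forall>\<^sub>F n in sequentially. \<exists>E\<in>sets M. measure M E \<le> \<delta> \<and> B n \<subseteq> E"
    by eventually_elim (use assms(1) in \<open>auto intro: less_imp_le\<close>)
qed

lemma (in finite_measure) asymp_null_imp_tendsto_0:
  assumes "asymp_null M B" "\<And>n. B n \<in> sets M"
  shows "(\<lambda>n. measure M (B n)) \<longlonglongrightarrow> 0"
proof (rule tendstoI)
  fix e :: real assume "e > 0"
  then have "\<forall>\<^sub>F n in sequentially. \<exists>E\<in>sets M. measure M E \<le> e / 2 \<and> B n \<subseteq> E"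
    by (intro asymp_nullD[OF assms(1)]) simp
  then show "\<forall>\<^sub>F n in sequentially. dist (measure M (B n)) 0 < e"
  proof eventually_elim
    case (elim n)
    then obtain E where "E \<in> sets M" "measure M E \<le> e / 2" "B n \<subseteq> E" by blast
    then show ?case
      using finite_measure_mono[of "B n" E] \<open>e > 0\<close> by simp
  qed
qed

section \<open>Growth and moment bounds under the true density\<close>

locale gaussian_mixture =
  fixes p0 m0 t0 :: "real ^ 'k::finite"
  assumes theta0: "(p0, m0, t0) \<in> Theta"
    and weights_pos: "\<And>j. p0 $ j > 0"
    and distinct_components: "\<And>j l. j \<noteq> l \<Longrightarrow> (m0 $ j, t0 $ j) \<noteq> (m0 $ l, t0 $ l)"
begin

definition f0 :: "real \<Rightarrow> real" where
  "f0 = mix_density (p0, m0, t0)"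

lemma f0_measurable [measurable]: "f0 \<in> borel_measurable borel"
  by (simp add: f0_def)

lemma f0_pos: "f0 x > 0"
  unfolding f0_def by (rule mix_density_pos[OF theta0])

lemma f0_eq: "f0 x = (\<Sum>j\<in>UNIV. p0 $ j * gauss (m0 $ j) (t0 $ j) x)"
  by (simp add: f0_def mix_density_eq)

lemma f0_le: "f0 x \<le> exp (norm t0)"
  unfolding f0_def by (rule mix_density_le_exp_norm[OF theta0])

text \<open>All log-ratios met later grow at most like C (1 + x^2). Chebyshev's inequality needs
  their squares to be integrable, hence this fourth-order weight.\<close>

lemma integrable_f0_moment4: "integrable lborel (\<lambda>x. f0 x * (1 + x\<^sup>2)\<^sup>2)"
proof -
  have "integrable lborel (\<lambda>x. gauss m t x * (1 + x\<^sup>2)\<^sup>2)" for m t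
  proof -
    have eq: "(1 + x\<^sup>2)\<^sup>2 = (1 + m\<^sup>2)\<^sup>2 * (x - m) ^ 0 + (4 * m * (1 + m\<^sup>2)) * (x - m) ^ 1
        + (2 + 6 * m\<^sup>2) * (x - m) ^ 2 + (4 * m) * (x - m) ^ 3 + (x - m) ^ 4" for x
      by algebra
    then have "gauss m t x * (1 + x\<^sup>2)\<^sup>2 = (1 + m\<^sup>2)\<^sup>2 * (gauss m t x * (x - m) ^ 0)
        + (4 * m * (1 + m\<^sup>2)) * (gauss m t x * (x - m) ^ 1)
        + (2 + 6 * m\<^sup>2) * (gauss m t x * (x - m) ^ 2) + (4 * m) * (gauss m t x * (x - m) ^ 3)
        + gauss m t x * (x - m) ^ 4" for x
    proof -
      have dist: "G * (A * y0 + B * y1 + C * y2 + D * y3 + y4)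
          = A * (G * y0) + B * (G * y1) + C * (G * y2) + D * (G * y3) + G * y4"
        for G A B C D y0 y1 y2 y3 y4 :: real
        by (simp add: algebra_simps)
      show ?thesis by (subst eq) (rule dist)
    qed
    then show ?thesis
      by (simp only:) (intro Bochner_Integration.integrable_add integrable_mult_right
          integrable_normal_moment exp_gt_zero)
  qed
  then show ?thesis
    by (simp add: f0_eq sum_distrib_right mult.assoc)
qed

lemma integrable_f0_mult:
  assumes [measurable]: "g \<in> borel_measurable borel" and "\<And>x. \<bar>g x\<bar> \<le> C * (1 + x\<^sup>2)"
  shows "integrable lborel (\<lambda>x. f0 x * g x)" "integrable lborel (\<lambda>x. f0 x * (g x)\<^sup>2)"
proof -
  show "integrable lborel (\<lambda>x. f0 x * (g x)\<^sup>2)"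
  proof (rule Bochner_Integration.integrable_bound[OF integrable_mult_right[of "C\<^sup>2", OF integrable_f0_moment4]])
    show "AE x in lborel. norm (f0 x * (g x)\<^sup>2) \<le> norm (C\<^sup>2 * (f0 x * (1 + x\<^sup>2)\<^sup>2))"
    proof (rule AE_I2)
      fix x
      have "(g x)\<^sup>2 \<le> (C * (1 + x\<^sup>2))\<^sup>2"
        using assms(2)[of x] by (metis abs_ge_zero power2_abs power_mono)
      then have "f0 x * (g x)\<^sup>2 \<le> f0 x * (C * (1 + x\<^sup>2))\<^sup>2"
        using f0_pos[of x] by (intro mult_left_mono) auto
      then show "norm (f0 x * (g x)\<^sup>2) \<le> norm (C\<^sup>2 * (f0 x * (1 + x\<^sup>2)\<^sup>2))"
        using f0_pos[of x] by (simp only: power_mult_distrib) (simp add: abs_mult mult.left_commute)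
    qed
  qed simp
  show "integrable lborel (\<lambda>x. f0 x * g x)"
  proof (rule Bochner_Integration.integrable_bound[OF integrable_mult_right[of C, OF integrable_f0_moment4]])
    show "AE x in lborel. norm (f0 x * g x) \<le> norm (C * (f0 x * (1 + x\<^sup>2)\<^sup>2))"
    proof (rule AE_I2)
      fix x
      have "0 \<le> C * (1 + x\<^sup>2)" using assms(2)[of x] by linarith
      then have "C \<ge> 0" by (metis add_pos_nonneg less_numeral_extra(1) zero_le_mult_iff zero_le_power2 not_less)
      then have "\<bar>g x\<bar> \<le> C * (1 + x\<^sup>2)\<^sup>2"
        using assms(2)[of x] mult_left_mono[of "1 + x\<^sup>2" "(1 + x\<^sup>2)\<^sup>2" C] self_le_power[of "1 + x\<^sup>2" 2]
        by simp
      then have "f0 x * \<bar>g x\<bar> \<le> f0 x * (C * (1 + x\<^sup>2)\<^sup>2)"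
        using f0_pos[of x] by (intro mult_left_mono) auto
      then show "norm (f0 x * g x) \<le> norm (C * (f0 x * (1 + x\<^sup>2)\<^sup>2))"
        using f0_pos[of x] \<open>C \<ge> 0\<close> by (simp add: abs_mult algebra_simps)
    qed
  qed simp
qed

lemma integrable_f0: "integrable lborel f0"
  using integrable_f0_mult(1)[of "\<lambda>_. 1" 1] by simp

lemma integral_f0: "(\<integral>x. f0 x \<partial>lborel) = 1"
  using theta0 by (simp add: f0_eq Theta_def)

text \<open>Keeping a single component bounds \<open>f0\<close> from below by a multiple of one
  Gaussian, whose negative logarithm is quadratic in x.\<close>

lemma ln_inverse_f0_bound: "\<exists>C\<ge>0. \<forall>x. ln (1 + 1 / f0 x) \<le> C * (1 + x\<^sup>2)"
proof -
  obtain j :: 'k where True by blast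
  define a where "a = p0 $ j * (exp (- t0 $ j) / sqrt (2 * pi))"
  define b where "b = 1 / (2 * exp (2 * t0 $ j))"
  have a: "a > 0" using weights_pos by (simp add: a_def)
  have b: "b > 0" by (simp add: b_def)
  define C where "C = ln (1 + 1 / a) + 2 * b * (1 + (m0 $ j)\<^sup>2)"
  have C: "C \<ge> 0" using a b by (simp add: C_def)
  have "ln (1 + 1 / f0 x) \<le> C * (1 + x\<^sup>2)" for x
  proof -
    define s where "s = b * (x - m0 $ j)\<^sup>2"
    have s: "s \<ge> 0" using b by (simp add: s_def)
    have "f0 x \<ge> p0 $ j * gauss (m0 $ j) (t0 $ j) x"
      unfolding f0_eq using weights_pos by (intro member_le_sum) (auto simp: less_imp_le)
    also have "p0 $ j * gauss (m0 $ j) (t0 $ j) x = a * exp (-s)"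
      by (simp add: gauss_eq a_def b_def s_def)
    finally have "1 / f0 x \<le> 1 / (a * exp (-s))"
      using a f0_pos[of x] by (intro divide_left_mono) auto
    also have "\<dots> = exp s / a" by (simp add: exp_minus field_simps)
    finally have "1 + 1 / f0 x \<le> exp s * (1 + 1 / a)"
      using s by (simp add: distrib_left) (smt (verit) one_le_exp_iff)
    then have "ln (1 + 1 / f0 x) \<le> ln (exp s * (1 + 1 / a))"
      using f0_pos[of x] a by (subst ln_le_cancel_iff) (auto intro!: add_pos_pos mult_pos_pos)
    also have "\<dots> = s + ln (1 + 1 / a)"
      using a by (subst ln_mult_pos) (auto intro: add_pos_pos)
    also have "s \<le> 2 * b * (1 + (m0 $ j)\<^sup>2) * (1 + x\<^sup>2)"
    proof -
      have "(x - m0 $ j)\<^sup>2 \<le> 2 * (x\<^sup>2 + (m0 $ j)\<^sup>2)"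
        using zero_le_power2[of "x + m0 $ j"] by (simp add: power2_eq_square algebra_simps)
      also have "\<dots> \<le> 2 * ((1 + (m0 $ j)\<^sup>2) * (1 + x\<^sup>2))"
        by (simp add: algebra_simps)
      finally show ?thesis using b by (simp add: s_def mult_left_mono)
    qed
    also have "ln (1 + 1 / a) \<le> ln (1 + 1 / a) * (1 + x\<^sup>2)"
      using a mult_left_mono[of 1 "1 + x\<^sup>2" "ln (1 + 1 / a)"] by (simp add: ln_ge_zero)
    finally show ?thesis by (simp add: C_def algebra_simps)
  qed
  then show ?thesis using C by blast
qed

lemma ln_ratio_bound:
  assumes "c \<ge> 0"
  shows "\<exists>C\<ge>0. \<forall>x. ln (1 + c / f0 x) \<le> C * (1 + x\<^sup>2)"
proof -
  obtain C where C: "C \<ge> 0" "\<And>x. ln (1 + 1 / f0 x) \<le> C * (1 + x\<^sup>2)"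
    using ln_inverse_f0_bound by blast
  have "ln (1 + c / f0 x) \<le> (ln (1 + c) + C) * (1 + x\<^sup>2)" for x
  proof -
    have "1 + c / f0 x \<le> (1 + c) * (1 + 1 / f0 x)"
      using f0_pos[of x] assms by (simp add: field_simps)
    then have "ln (1 + c / f0 x) \<le> ln ((1 + c) * (1 + 1 / f0 x))"
      using f0_pos[of x] assms by (subst ln_le_cancel_iff) (auto intro!: add_pos_nonneg mult_pos_pos)
    also have "\<dots> = ln (1 + c) + ln (1 + 1 / f0 x)"
      using f0_pos[of x] assms by (intro ln_mult_pos) (auto intro: add_pos_nonneg)
    also have "\<dots> \<le> ln (1 + c) * (1 + x\<^sup>2) + C * (1 + x\<^sup>2)"
      using C(2)[of x] assms mult_left_mono[of 1 "1 + x\<^sup>2" "ln (1 + c)"]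
      by (intro add_mono) (simp_all add: ln_ge_zero)
    finally show ?thesis by (simp add: algebra_simps)
  qed
  then show ?thesis using C(1) assms by (intro exI[of _ "ln (1 + c) + C"]) auto
qed

end

section \<open>Close pairs in the sample\<close>

text \<open>K points in a window of radius \<open>h\<close> form K^2 - K ordered pairs at distance
  at most 2 h, and (K - 1)^2 \<le> K^2 - K. The hypothesis does not involve the centre
  \<open>m\<close>, so the bound holds for all windows of this radius together. The summand 1
  reflects that a single point forms no pair.\<close>

lemma card_close_pairs_bound:
  fixes x :: "nat \<Rightarrow> real"
  assumes "real (card {(i, j). i < n \<and> j < n \<and> i \<noteq> j \<and> \<bar>x i - x j\<bar> \<le> 2 * h}) \<le> (real n * b)\<^sup>2"
    and "b \<ge> 0"
  shows "real (card {i. i < n \<and> \<bar>x i - m\<bar> \<le> h}) \<le> 1 + real n * b"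
proof (cases "card {i. i < n \<and> \<bar>x i - m\<bar> \<le> h} = 0")
  case False
  define W where "W = {i. i < n \<and> \<bar>x i - m\<bar> \<le> h}"
  define K where "K = card W"
  have fin: "finite W" by (simp add: W_def)
  have K: "K \<ge> 1" using False unfolding K_def W_def by linarith
  have eq: "{(i, j). i \<in> W \<and> j \<in> W \<and> i \<noteq> j} = W \<times> W - (\<lambda>i. (i, i)) ` W" by auto
  have "card ((\<lambda>i. (i, i)) ` W) = K"
    unfolding K_def by (intro card_image) (auto intro: inj_onI)
  then have "card {(i, j). i \<in> W \<and> j \<in> W \<and> i \<noteq> j} = K * K - K"
    unfolding eq using fin by (subst card_Diff_subset) (auto simp: K_def)
  moreover have "card {(i, j). i \<in> W \<and> j \<in> W \<and> i \<noteq> j}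
      \<le> card {(i, j). i < n \<and> j < n \<and> i \<noteq> j \<and> \<bar>x i - x j\<bar> \<le> 2 * h}"
  proof (rule card_mono)
    show "finite {(i, j). i < n \<and> j < n \<and> i \<noteq> j \<and> \<bar>x i - x j\<bar> \<le> 2 * h}"
      by (rule finite_subset[of _ "{..<n} \<times> {..<n}"]) auto
  qed (auto simp: W_def)
  ultimately have "real (K * K - K) \<le> (real n * b)\<^sup>2" using assms(1) by linarith
  moreover have "(real K - 1)\<^sup>2 \<le> real (K * K - K)"
    using K by (simp add: of_nat_diff power2_eq_square algebra_simps)
  ultimately have "(real K - 1)\<^sup>2 \<le> (real n * b)\<^sup>2" by linarith
  then have "real K - 1 \<le> real n * b"
    by (rule power2_le_imp_le) (use assms(2) in simp)
  then show ?thesis by (simp add: K_def W_def)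
next
  case True
  then show ?thesis using assms(2) by (simp only:) simp
qed

locale gaussian_mixture_sample = gaussian_mixture p0 m0 t0 + prob_space M
  for p0 m0 t0 :: "real ^ 'k::finite" and M :: "'a measure" +
  fixes X :: "nat \<Rightarrow> 'a \<Rightarrow> real"
  assumes indep: "indep_vars (\<lambda>_. borel) X UNIV"
    and ident: "\<And>i. distributed M lborel (X i) (\<lambda>x. ennreal (f0 x))"
begin

lemma X_measurable [measurable]: "X i \<in> borel_measurable M"
  using distributed_measurable[OF ident[of i]] by simp

lemma expectation_eq:
  "g \<in> borel_measurable borel \<Longrightarrow> expectation (\<lambda>\<omega>. g (X i \<omega>)) = (\<integral>x. f0 x * g x \<partial>lborel)"
  using distributed_integral[OF ident[of i], of g] f0_pos by (simp add: less_imp_le)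

lemma integrable_iff:
  "g \<in> borel_measurable borel \<Longrightarrow> integrable M (\<lambda>\<omega>. g (X i \<omega>)) \<longleftrightarrow> integrable lborel (\<lambda>x. f0 x * g x)"
  using distributed_integrable[OF ident[of i], of g] f0_pos by (simp add: less_imp_le)

text \<open>Quadratic growth makes the variance finite through the fourth moment of
  \<open>f0\<close>. Only upper deviations are recorded, since all later estimates bound sums from
  above.\<close>

lemma weak_law:
  assumes g [measurable]: "g \<in> borel_measurable borel" and bound: "\<And>x. \<bar>g x\<bar> \<le> C * (1 + x\<^sup>2)" and e: "e > 0"
  shows "asymp_null M (\<lambda>n. {\<omega> \<in> space M. (\<Sum>i<n. g (X i \<omega>)) > n * ((\<integral>x. f0 x * g x \<partial>lborel) + e)})"
proof -
  define a where "a = (\<integral>x. f0 x * g x \<partial>lborel)"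
  define Z where "Z = (\<lambda>i \<omega>. g (X i \<omega>) - a)"
  have C: "C \<ge> 0" using bound[of 0] by simp
  have bound': "\<bar>g x - a\<bar> \<le> (C + \<bar>a\<bar>) * (1 + x\<^sup>2)" for x
  proof -
    have "\<bar>a\<bar> * 1 \<le> \<bar>a\<bar> * (1 + x\<^sup>2)" by (intro mult_left_mono) auto
    then show ?thesis
      using bound[of x] abs_triangle_ineq4[of "g x" a] unfolding distrib_right by linarith
  qed
  define v where "v = (\<integral>x. f0 x * (g x - a)\<^sup>2 \<partial>lborel)"
  have "indep_vars (\<lambda>_. borel) Z UNIV"
    unfolding Z_def by (rule indep_vars_compose2[OF indep, of "\<lambda>_ x. g x - a"]) simp
  moreover have "integrable M (\<lambda>\<omega>. (Z i \<omega>)\<^sup>2)" for i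
    unfolding Z_def using integrable_iff[of "\<lambda>x. (g x - a)\<^sup>2" i] integrable_f0_mult(2)[OF _ bound'] by simp
  moreover have "expectation (\<lambda>\<omega>. (Z i \<omega>)\<^sup>2) = v" for i
    unfolding Z_def v_def by (rule expectation_eq) simp
  moreover have "expectation (Z i) = 0" for i
  proof -
    have "integrable M (\<lambda>\<omega>. g (X i \<omega>))"
      using integrable_iff[OF g] integrable_f0_mult(1)[OF g bound] by simp
    then show ?thesis
      unfolding Z_def by (simp add: expectation_eq prob_space a_def[symmetric])
  qed
  ultimately have cheb: "prob {\<omega> \<in> space M. n * e \<le> \<bar>\<Sum>i<n. Z i \<omega>\<bar>} \<le> v / (n * e\<^sup>2)" if "n > 0" for n
    using weak_law_chebyshev[of Z v n e] that e by blast
  have "asymp_null M (\<lambda>n. {\<omega> \<in> space M. n * e \<le> \<bar>\<Sum>i<n. Z i \<omega>\<bar>})"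
  proof (rule asymp_nullI_tendsto)
    show "{\<omega> \<in> space M. n * e \<le> \<bar>\<Sum>i<n. Z i \<omega>\<bar>} \<in> sets M" for n
      unfolding Z_def by measurable
    show "(\<lambda>n. prob {\<omega> \<in> space M. n * e \<le> \<bar>\<Sum>i<n. Z i \<omega>\<bar>}) \<longlonglongrightarrow> 0"
    proof (rule tendsto_sandwich[OF _ _ tendsto_const])
      show "(\<lambda>n. v / (n * e\<^sup>2)) \<longlonglongrightarrow> 0"
        using e by real_asymp
      show "\<forall>\<^sub>F n in sequentially. prob {\<omega> \<in> space M. n * e \<le> \<bar>\<Sum>i<n. Z i \<omega>\<bar>} \<le> v / (n * e\<^sup>2)"
        using eventually_gt_at_top[of 0] by eventually_elim (rule cheb)
    qed simp
  qed
  then show ?thesis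
  proof (rule asymp_null_mono, intro always_eventually allI subsetI)
    fix n \<omega> assume "\<omega> \<in> {\<omega> \<in> space M. (\<Sum>i<n. g (X i \<omega>)) > n * ((\<integral>x. f0 x * g x \<partial>lborel) + e)}"
    then show "\<omega> \<in> {\<omega> \<in> space M. n * e \<le> \<bar>\<Sum>i<n. Z i \<omega>\<bar>}"
      by (auto simp: Z_def sum_subtractf a_def distrib_left intro: order_trans[OF _ abs_ge_self])
  qed
qed

text \<open>By Fubini it suffices to fix one observation: the other must fall into an interval of
  length 2 h, and its density is bounded by \<open>exp (norm t0)\<close>.\<close>

lemma prob_close_le:
  assumes "i \<noteq> j" "h \<ge> 0"
  shows "prob {\<omega> \<in> space M. \<bar>X i \<omega> - X j \<omega>\<bar> \<le> h} \<le> 2 * h * exp (norm t0)"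
proof -
  define D where "D = density lborel (\<lambda>x. ennreal (f0 x))"
  have D: "distr M borel (X i) = D" for i
    using ident[of i] unfolding distributed_def D_def by (simp cong: distr_cong)
  interpret D: prob_space D
    unfolding D[of 0, symmetric] by (rule prob_space_distr) simp
  have [measurable_cong]: "sets D = sets borel" by (simp add: D_def)
  define B where "B = {z :: real \<times> real. \<bar>fst z - snd z\<bar> \<le> h}"
  have "closed B"
    unfolding B_def by (intro closed_Collect_le continuous_intros)
  then have B [measurable]: "B \<in> sets (borel \<Otimes>\<^sub>M borel)"
    using borel_closed[of B] unfolding borel_prod by blast
  have set_eq: "{\<omega> \<in> space M. \<bar>X i \<omega> - X j \<omega>\<bar> \<le> h} = (\<lambda>\<omega>. (X i \<omega>, X j \<omega>)) -` B \<inter> space M"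
    by (auto simp: B_def)
  have "emeasure M {\<omega> \<in> space M. \<bar>X i \<omega> - X j \<omega>\<bar> \<le> h}
      = emeasure (distr M (borel \<Otimes>\<^sub>M borel) (\<lambda>\<omega>. (X i \<omega>, X j \<omega>))) B"
    unfolding set_eq by (rule emeasure_distr[symmetric]) measurable
  also have "\<dots> = emeasure (D \<Otimes>\<^sub>M D) B"
    using indep_vars_imp_indep_var[OF indep assms(1)] unfolding indep_var_distribution_eq D by simp
  also have "\<dots> = (\<integral>\<^sup>+x. emeasure D (Pair x -` B) \<partial>D)"
    by (rule D.emeasure_pair_measure_alt) measurable
  also have "\<dots> \<le> (\<integral>\<^sup>+x. ennreal (2 * h * exp (norm t0)) \<partial>D)"
  proof (rule nn_integral_mono)
    fix x
    have eq: "Pair x -` B = {x - h .. x + h}" by (auto simp: B_def)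
    have "emeasure D {x - h .. x + h} = (\<integral>\<^sup>+y. ennreal (f0 y) * indicator {x - h .. x + h} y \<partial>lborel)"
      unfolding D_def by (rule emeasure_density) auto
    also have "\<dots> \<le> (\<integral>\<^sup>+y. ennreal (exp (norm t0)) * indicator {x - h .. x + h} y \<partial>lborel)"
      by (intro nn_integral_mono mult_right_mono ennreal_leI f0_le) simp
    also have "\<dots> = ennreal (exp (norm t0)) * ennreal (2 * h)"
      using assms(2) by (simp add: nn_integral_cmult)
    also have "\<dots> = ennreal (2 * h * exp (norm t0))"
      using assms(2) by (simp add: ennreal_mult'[symmetric] mult.commute)
    finally show "emeasure D (Pair x -` B) \<le> ennreal (2 * h * exp (norm t0))" unfolding eq .
  qed
  also have "\<dots> = ennreal (2 * h * exp (norm t0))"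
    by (simp add: D.emeasure_space_1)
  finally show ?thesis
    using assms(2) by (simp add: emeasure_eq_measure)
qed

definition close_pairs :: "nat \<Rightarrow> real \<Rightarrow> 'a \<Rightarrow> nat" where
  "close_pairs n h \<omega> = card {(i, j). i < n \<and> j < n \<and> i \<noteq> j \<and> \<bar>X i \<omega> - X j \<omega>\<bar> \<le> h}"

lemma close_pairs_eq_sum:
  "real (close_pairs n h \<omega>) = (\<Sum>i<n. \<Sum>j\<in>{..<n} - {i}. indicator {\<omega>. \<bar>X i \<omega> - X j \<omega>\<bar> \<le> h} \<omega>)"
proof -
  have "{(i, j). i < n \<and> j < n \<and> i \<noteq> j \<and> \<bar>X i \<omega> - X j \<omega>\<bar> \<le> h}
      = (SIGMA i:{..<n}. {j\<in>{..<n} - {i}. \<bar>X i \<omega> - X j \<omega>\<bar> \<le> h})" by auto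
  then have "real (close_pairs n h \<omega>) = (\<Sum>i<n. real (card {j\<in>{..<n} - {i}. \<bar>X i \<omega> - X j \<omega>\<bar> \<le> h}))"
    unfolding close_pairs_def by (simp add: card_SigmaI)
  also have "\<dots> = (\<Sum>i<n. \<Sum>j\<in>{..<n} - {i}. indicator {\<omega>. \<bar>X i \<omega> - X j \<omega>\<bar> \<le> h} \<omega>)"
  proof (rule sum.cong[OF refl])
    fix i
    have "(\<Sum>j\<in>{..<n} - {i}. indicator {\<omega>. \<bar>X i \<omega> - X j \<omega>\<bar> \<le> h} \<omega>)
        = (\<Sum>j\<in>{..<n} - {i}. if \<bar>X i \<omega> - X j \<omega>\<bar> \<le> h then 1 else (0::real))"
      by (intro sum.cong) (auto simp: indicator_def)
    then show "real (card {j\<in>{..<n} - {i}. \<bar>X i \<omega> - X j \<omega>\<bar> \<le> h})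
        = (\<Sum>j\<in>{..<n} - {i}. indicator {\<omega>. \<bar>X i \<omega> - X j \<omega>\<bar> \<le> h} \<omega>)"
      by (simp add: sum.If_cases Int_def)
  qed
  finally show ?thesis .
qed

text \<open>By Markov's inequality: at most n^2 ordered pairs contribute to the expectation, and the
  threshold carries the same factor n^2. The resulting bound is free of n, so one starting scale can
  later serve all sample sizes.\<close>

lemma prob_close_pairs_gt:
  assumes "h \<ge> 0" "b > 0"
  shows "{\<omega> \<in> space M. real (close_pairs n h \<omega>) > (real n)\<^sup>2 * b} \<in> events"
    and "prob {\<omega> \<in> space M. real (close_pairs n h \<omega>) > (real n)\<^sup>2 * b} \<le> 2 * h * exp (norm t0) / b"
proof -
  have [measurable]: "{\<omega>. \<bar>X i \<omega> - X j \<omega>\<bar> \<le> h} \<inter> space M \<in> events" for i j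
    by (simp add: Int_def conj_commute)
  have ind: "integrable M (indicator {\<omega>. \<bar>X i \<omega> - X j \<omega>\<bar> \<le> h} :: 'a \<Rightarrow> real)" for i j
    by (intro integrable_indicator_iff[THEN iffD2]) (auto simp: emeasure_eq_measure)
  have int: "integrable M (\<lambda>\<omega>. real (close_pairs n h \<omega>))"
    unfolding close_pairs_eq_sum by (intro Bochner_Integration.integrable_sum ind)
  then have [measurable]: "(\<lambda>\<omega>. real (close_pairs n h \<omega>)) \<in> borel_measurable M" by simp
  show "{\<omega> \<in> space M. real (close_pairs n h \<omega>) > (real n)\<^sup>2 * b} \<in> events" by simp
  show "prob {\<omega> \<in> space M. real (close_pairs n h \<omega>) > (real n)\<^sup>2 * b} \<le> 2 * h * exp (norm t0) / b"
  proof (cases "n = 0")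
    case True
    then show ?thesis using assms by (simp add: close_pairs_def)
  next
    case False
    define q where "q = 2 * h * exp (norm t0)"
    have q: "q \<ge> 0" using assms by (simp add: q_def)
    have "expectation (\<lambda>\<omega>. real (close_pairs n h \<omega>))
        = (\<Sum>i<n. \<Sum>j\<in>{..<n} - {i}. prob ({\<omega>. \<bar>X i \<omega> - X j \<omega>\<bar> \<le> h} \<inter> space M))"
      unfolding close_pairs_eq_sum
      by (simp add: Bochner_Integration.integral_sum Bochner_Integration.integrable_sum ind)
    also have "\<dots> \<le> (\<Sum>i<n. \<Sum>j\<in>{..<n} - {i}. q)"
      unfolding q_def using prob_close_le assms
      by (intro sum_mono) (auto simp: Int_def conj_commute)
    also have "\<dots> \<le> (\<Sum>i<n. \<Sum>j<n. q)"
      using q by (intro sum_mono sum_mono2) auto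
    also have "\<dots> = (real n)\<^sup>2 * q" by (simp add: power2_eq_square)
    finally have E: "expectation (\<lambda>\<omega>. real (close_pairs n h \<omega>)) \<le> (real n)\<^sup>2 * q" .
    have "prob {\<omega> \<in> space M. real (close_pairs n h \<omega>) > (real n)\<^sup>2 * b}
        \<le> prob {\<omega> \<in> space M. real (close_pairs n h \<omega>) \<ge> (real n)\<^sup>2 * b}"
      by (intro finite_measure_mono) auto
    also have "\<dots> \<le> expectation (\<lambda>\<omega>. real (close_pairs n h \<omega>)) / ((real n)\<^sup>2 * b)"
      using False assms by (intro integral_Markov_inequality_measure[where A = "{}"] int) auto
    also have "\<dots> \<le> (real n)\<^sup>2 * q / ((real n)\<^sup>2 * b)"
      using E assms by (intro divide_right_mono) auto
    finally show ?thesis using False by (simp add: q_def)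
  qed
qed

text \<open>A component with standard deviation \<open>exp (-m)\<close> is negligible at distance more than the
  square root \<open>exp (-m / 2)\<close> from its mean, so these are the window radii that matter.\<close>

definition scattered :: "nat \<Rightarrow> nat \<Rightarrow> 'a \<Rightarrow> bool" where
  "scattered N n \<omega> \<longleftrightarrow>
     (\<forall>m\<ge>N. real (close_pairs n (2 * exp (- real m / 2)) \<omega>) \<le> (real n)\<^sup>2 * exp (- real m / 4))"

text \<open>At scale m the radius \<open>2 * exp (- m / 2)\<close> and the threshold
  \<open>exp (- m / 4)\<close> turn the pair estimate into \<open>C * q ^ m\<close> with
  \<open>q = exp (- 1 / 4)\<close>. The union bound over all scales from N on is the tail of a
  geometric series.\<close>

lemma prob_not_scattered:
  assumes "\<delta> > 0"
  shows "\<exists>N. \<forall>n. {\<omega> \<in> space M. \<not> scattered N n \<omega>} \<in> events \<and>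
      prob {\<omega> \<in> space M. \<not> scattered N n \<omega>} \<le> \<delta>"
proof -
  define q where "q = exp (- 1 / 4 :: real)"
  define C where "C = 4 * exp (norm t0)"
  have q: "0 < q" "q < 1" by (auto simp: q_def)
  have qpow: "exp (- real m / 4) = q ^ m" for m
    by (simp add: q_def exp_of_nat_mult[symmetric])
  have "(\<lambda>N. C * q ^ N / (1 - q)) \<longlonglongrightarrow> C * 0 / (1 - q)"
    using q by (intro tendsto_intros LIMSEQ_realpow_zero) auto
  then have "\<forall>\<^sub>F N in sequentially. C * q ^ N / (1 - q) < \<delta>"
    using assms by (intro order_tendstoD(2)[where y = "C * 0 / (1 - q)"]) auto
  then obtain N where N: "C * q ^ N / (1 - q) < \<delta>"
    by (auto simp: eventually_sequentially)
  have "{\<omega> \<in> space M. \<not> scattered N n \<omega>} \<in> events \<and>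
      prob {\<omega> \<in> space M. \<not> scattered N n \<omega>} \<le> \<delta>" for n
  proof -
    define A where "A = (\<lambda>m. {\<omega> \<in> space M. real (close_pairs n (2 * exp (- real (m + N) / 2)) \<omega>)
        > (real n)\<^sup>2 * exp (- real (m + N) / 4)})"
    have eq: "{\<omega> \<in> space M. \<not> scattered N n \<omega>} = (\<Union>m. A m)"
    proof -
      have "(\<forall>m\<ge>N. P m) \<longleftrightarrow> (\<forall>m. P (m + N))" for P
        by (auto simp: nat_le_iff_add add.commute)
      then show ?thesis
        unfolding A_def scattered_def by (simp only: not_all not_le) blast
    qed
    have A: "A m \<in> events" "prob (A m) \<le> C * q ^ N * q ^ m" for m
    proof -
      show "A m \<in> events" unfolding A_def by (rule prob_close_pairs_gt) auto
      have "prob (A m) \<le> 2 * (2 * exp (- real (m + N) / 2)) * exp (norm t0) / exp (- real (m + N) / 4)"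
        unfolding A_def by (rule prob_close_pairs_gt) auto
      also have "\<dots> = C * (exp (- real (m + N) / 2) / exp (- real (m + N) / 4))"
        by (simp add: C_def)
      also have "exp (- real (m + N) / 2) / exp (- real (m + N) / 4) = exp (- real (m + N) / 4)"
        by (simp add: exp_diff[symmetric])
      also have "\<dots> = q ^ N * q ^ m" unfolding qpow by (simp add: power_add)
      finally show "prob (A m) \<le> C * q ^ N * q ^ m" by simp
    qed
    have sums: "(\<lambda>m. C * q ^ N * q ^ m) sums (C * q ^ N * (1 / (1 - q)))"
      using q by (intro sums_mult geometric_sums) auto
    have summ: "summable (\<lambda>m. prob (A m))"
      by (rule summable_comparison_test[OF _ sums_summable[OF sums]]) (use A in auto)
    have "prob (\<Union>m. A m) \<le> (\<Sum>m. prob (A m))"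
      using A(1) by (intro finite_measure_subadditive_countably summ) auto
    also have "\<dots> \<le> (\<Sum>m. C * q ^ N * q ^ m)"
      using A(2) summ sums by (intro suminf_le) (auto simp: sums_iff)
    also have "\<dots> = C * q ^ N / (1 - q)" using sums by (simp add: sums_iff)
    finally show ?thesis unfolding eq using A(1) N by auto
  qed
  then show ?thesis by blast
qed

text \<open>A real \<open>t\<close> is rounded to the integer scale k, the floor of -t. Since k
  \<le> -t, the window at scale k contains the given one; since -t < k + 1, rounding costs at most
  the 1 in \<open>(t + 1) / 8\<close>. The 8 is twice the 4 of the pair threshold, because counting
  points takes a square root.\<close>

lemma scattered_window:
  assumes "scattered N n \<omega>" "t \<le> - real N"
  shows "real (card {i. i < n \<and> \<bar>X i \<omega> - m\<bar> \<le> exp (t / 2)}) \<le> 1 + real n * exp ((t + 1) / 8)"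
proof -
  define k where "k = nat \<lfloor>-t\<rfloor>"
  have t: "-t \<ge> 0" using assms(2) by simp
  then have k: "real k \<le> -t" "-t < real k + 1" unfolding k_def by linarith+
  have "k \<ge> N" unfolding k_def using assms(2) by linarith
  then have "real (close_pairs n (2 * exp (- real k / 2)) \<omega>) \<le> (real n)\<^sup>2 * exp (- real k / 4)"
    using assms(1) by (simp add: scattered_def)
  moreover have "(real n)\<^sup>2 * exp (- real k / 4) = (real n * exp (- real k / 8))\<^sup>2"
    by (simp add: power_mult_distrib exp_double[symmetric])
  ultimately have "real (card {i. i < n \<and> \<bar>X i \<omega> - m\<bar> \<le> exp (- real k / 2)}) \<le> 1 + real n * exp (- real k / 8)"
    unfolding close_pairs_def by (intro card_close_pairs_bound) simp_all
  moreover have "card {i. i < n \<and> \<bar>X i \<omega> - m\<bar> \<le> exp (t / 2)} \<le> card {i. i < n \<and> \<bar>X i \<omega> - m\<bar> \<le> exp (- real k / 2)}"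
  proof (rule card_mono)
    have "exp (t / 2) \<le> exp (- real k / 2)" using k by simp
    then show "{i. i < n \<and> \<bar>X i \<omega> - m\<bar> \<le> exp (t / 2)} \<subseteq> {i. i < n \<and> \<bar>X i \<omega> - m\<bar> \<le> exp (- real k / 2)}"
      by (auto intro: order_trans)
  qed simp
  moreover have "real n * exp (- real k / 8) \<le> real n * exp ((t + 1) / 8)"
    using k by (intro mult_left_mono) auto
  ultimately show ?thesis by linarith
qed

end

section \<open>Narrow components and the Gibbs inequality\<close>

lemma ln_one_plus_mono: "0 \<le> a \<Longrightarrow> a \<le> b \<Longrightarrow> ln (1 + a) \<le> ln (1 + b :: real)"
  by (subst ln_le_cancel_iff) auto

context gaussian_mixture
begin

lemma mean_tendsto:
  assumes [measurable]: "\<And>N. g N \<in> borel_measurable borel" "g' \<in> borel_measurable borel"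
    and bound: "\<And>N x. \<bar>g N x\<bar> \<le> C * (1 + x\<^sup>2)"
    and lim: "\<And>x. (\<lambda>N. g N x) \<longlonglongrightarrow> g' x"
  shows "(\<lambda>N. \<integral>x. f0 x * g N x \<partial>lborel) \<longlonglongrightarrow> (\<integral>x. f0 x * g' x \<partial>lborel)"
proof (rule integral_dominated_convergence[where w = "\<lambda>x. f0 x * (C * (1 + x\<^sup>2))"])
  have C: "C \<ge> 0" using bound[of 0 0] by simp
  show "integrable lborel (\<lambda>x. f0 x * (C * (1 + x\<^sup>2)))"
    by (rule integrable_f0_mult(1)[where C = C]) (use C in \<open>auto simp: abs_mult\<close>)
  show "AE x in lborel. norm (f0 x * g N x) \<le> f0 x * (C * (1 + x\<^sup>2))" for N
    using bound f0_pos by (intro AE_I2) (simp add: abs_mult mult_left_mono less_imp_le)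
  show "AE x in lborel. (\<lambda>N. f0 x * g N x) \<longlonglongrightarrow> f0 x * g' x"
    by (intro AE_I2 tendsto_intros lim)
qed simp_all

text \<open>An observation in the window of a narrow component may cost -t + ln (1 + 1 / f0).
  Cutting the second term at a level leaves a bounded cost per observation in the window and an
  excess that does not depend on the component. This excess is small in mean, so it can be charged
  to the whole sample.\<close>

lemma mean_tail_small:
  assumes "e > 0"
  shows "\<exists>N. (\<integral>x. f0 x * max 0 (ln (1 + 1 / f0 x) - real N) \<partial>lborel) < e"
proof -
  obtain C where C: "C \<ge> 0" "\<And>x. ln (1 + 1 / f0 x) \<le> C * (1 + x\<^sup>2)"
    using ln_inverse_f0_bound by blast
  have "(\<lambda>N. \<integral>x. f0 x * max 0 (ln (1 + 1 / f0 x) - real N) \<partial>lborel) \<longlonglongrightarrow> (\<integral>x. f0 x * 0 \<partial>lborel)"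
  proof (rule mean_tendsto)
    fix N :: nat and x :: real
    have "0 \<le> C * (1 + x\<^sup>2)" using C(1) by simp
    then show "\<bar>max 0 (ln (1 + 1 / f0 x) - real N)\<bar> \<le> C * (1 + x\<^sup>2)"
      using C(2)[of x] by simp
    have "\<forall>\<^sub>F N in sequentially. ln (1 + 1 / f0 x) \<le> real N"
      using filterlim_real_sequentially by (rule filterlim_at_top[THEN iffD1, rule_format])
    then have "\<forall>\<^sub>F N in sequentially. max 0 (ln (1 + 1 / f0 x) - real N) = 0"
      by eventually_elim simp
    then show "(\<lambda>N. max 0 (ln (1 + 1 / f0 x) - real N)) \<longlonglongrightarrow> 0"
      by (rule tendsto_eventually)
  qed simp_all
  then have "\<forall>\<^sub>F N in sequentially. (\<integral>x. f0 x * max 0 (ln (1 + 1 / f0 x) - real N) \<partial>lborel) < e"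
    by (rule order_tendstoD(2)) (use assms in simp)
  then show ?thesis by (auto simp: eventually_sequentially)
qed

text \<open>Outside its window a narrow component is bounded by a small constant whatever its mean,
  so one average covers the outside contribution of every narrow component.\<close>

lemma mean_background_small:
  assumes "e > 0"
  shows "\<exists>N. (\<integral>x. f0 x * ln (1 + 8 * exp (- real N) / f0 x) \<partial>lborel) < e"
proof -
  obtain C where C: "C \<ge> 0" "\<And>x. ln (1 + 8 / f0 x) \<le> C * (1 + x\<^sup>2)"
    using ln_ratio_bound[of 8] by auto
  have "(\<lambda>N. \<integral>x. f0 x * ln (1 + 8 * exp (- real N) / f0 x) \<partial>lborel) \<longlonglongrightarrow> (\<integral>x. f0 x * ln 1 \<partial>lborel)"
  proof (rule mean_tendsto)
    fix N :: nat and x :: real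
    have "ln (1 + 8 * exp (- real N) / f0 x) \<le> ln (1 + 8 / f0 x)"
      using f0_pos[of x] by (intro ln_one_plus_mono divide_right_mono) auto
    moreover have "0 \<le> ln (1 + 8 * exp (- real N) / f0 x)"
      using f0_pos[of x] by (intro ln_ge_zero) auto
    ultimately show "\<bar>ln (1 + 8 * exp (- real N) / f0 x)\<bar> \<le> C * (1 + x\<^sup>2)"
      using C(2)[of x] by simp
    have "(\<lambda>N. exp (- real N)) \<longlonglongrightarrow> 0" by real_asymp
    then have "(\<lambda>N. ln (1 + 8 * exp (- real N) / f0 x)) \<longlonglongrightarrow> ln (1 + 8 * 0 / f0 x)"
      using f0_pos[of x] by (intro tendsto_intros) auto
    then show "(\<lambda>N. ln (1 + 8 * exp (- real N) / f0 x)) \<longlonglongrightarrow> ln 1" by simp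
  qed simp_all
  then have "\<forall>\<^sub>F N in sequentially. (\<integral>x. f0 x * ln (1 + 8 * exp (- real N) / f0 x) \<partial>lborel) < e"
    by (rule order_tendstoD(2)) (use assms in simp)
  then show ?thesis by (auto simp: eventually_sequentially)
qed

text \<open>Away from its mean a narrow component is at most \<open>8 * exp t\<close>, and in the window
  \<open>\<bar>x - m\<bar> \<le> exp (t / 2)\<close> around the mean its logarithm is at most \<open>-t\<close>.\<close>

lemma ln_narrow_le:
  assumes "t \<le> - T" "T \<ge> 0" "R \<ge> 0"
  shows "ln (1 + gauss m t x / f0 x) \<le> ln (1 + 8 * exp (-T) / f0 x) + max 0 (ln (1 + 1 / f0 x) - R)
      + (if \<bar>x - m\<bar> \<le> exp (t / 2) then - t + R else 0)"
proof -
  have f: "f0 x > 0" by (rule f0_pos)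
  have nn: "0 \<le> ln (1 + 8 * exp (-T) / f0 x)" using f by (intro ln_ge_zero) auto
  have g: "gauss m t x / f0 x \<ge> 0" using f gauss_pos[of m t x] by simp
  show ?thesis
  proof (cases "\<bar>x - m\<bar> \<le> exp (t / 2)")
    case False
    then have "gauss m t x \<le> 8 * exp t" by (intro gauss_le_far) simp
    also have "\<dots> \<le> 8 * exp (-T)" using assms by simp
    finally have "ln (1 + gauss m t x / f0 x) \<le> ln (1 + 8 * exp (-T) / f0 x)"
      using f g by (intro ln_one_plus_mono divide_right_mono) auto
    then show ?thesis using False by simp
  next
    case True
    have "1 + gauss m t x / f0 x \<le> exp (-t) * (1 + 1 / f0 x)"
    proof -
      have "gauss m t x / f0 x \<le> exp (-t) / f0 x"
        using f gauss_le[of t t m x] by (intro divide_right_mono) auto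
      moreover have "1 \<le> exp (-t)" using assms by simp
      ultimately show ?thesis unfolding distrib_left by (simp del: one_le_exp_iff)
    qed
    then have "ln (1 + gauss m t x / f0 x) \<le> ln (exp (-t) * (1 + 1 / f0 x))"
      using f g by (intro ln_mono) (auto intro: add_pos_nonneg)
    also have "\<dots> = -t + ln (1 + 1 / f0 x)"
      using f by (subst ln_mult_pos) (auto intro: add_pos_pos)
    finally show ?thesis using True nn by simp
  qed
qed

text \<open>Averaging with \<open>f0\<close> keeps the argument of the logarithm at least 1/2 even
  where \<open>y\<close> vanishes. The plain log-ratio has no such lower bound, and a limit mixture
  may have lost all its components.\<close>

lemma ln_average_bound:
  assumes "c \<ge> 0"
  shows "\<exists>C. \<forall>x y. 0 \<le> y \<longrightarrow> y \<le> c \<longrightarrow> \<bar>ln ((y + f0 x) / (2 * f0 x))\<bar> \<le> C * (1 + x\<^sup>2)"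
proof -
  obtain C where C: "C \<ge> 0" "\<And>x. ln (1 + c / f0 x) \<le> C * (1 + x\<^sup>2)"
    using ln_ratio_bound[OF assms] by blast
  have "\<bar>ln ((y + f0 x) / (2 * f0 x))\<bar> \<le> (C + ln 2) * (1 + x\<^sup>2)" if y: "0 \<le> y" "y \<le> c" for x y
  proof -
    define z where "z = (y + f0 x) / (2 * f0 x)"
    have f: "f0 x > 0" by (rule f0_pos)
    have "z = 1/2 + y / (2 * f0 x)" using f by (simp add: z_def field_simps)
    moreover have "y / (2 * f0 x) \<le> c / f0 x"
      using y f by (intro frac_le) auto
    moreover have "y / (2 * f0 x) \<ge> 0" using y f by simp
    ultimately have "z \<le> 1 + c / f0 x" "1 / 2 \<le> z" by linarith+
    then have "ln z \<le> ln (1 + c / f0 x)" "ln (1 / 2) \<le> ln z"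
      by (intro ln_mono; simp)+
    moreover have "ln (1 + c / f0 x) \<le> C * (1 + x\<^sup>2)" by (rule C(2))
    moreover have "0 \<le> C * (1 + x\<^sup>2)" "0 \<le> ln 2 * x\<^sup>2" using C(1) by auto
    moreover have "(C + ln 2) * (1 + x\<^sup>2) = C * (1 + x\<^sup>2) + (ln 2 + ln 2 * x\<^sup>2)"
      by (simp add: algebra_simps)
    moreover have "ln (1 / 2) = - ln (2 :: real)" by (simp add: ln_div)
    moreover have "0 < ln (2 :: real)" by simp
    ultimately have "\<bar>ln z\<bar> \<le> (C + ln 2) * (1 + x\<^sup>2)" by linarith
    then show ?thesis by (simp add: z_def)
  qed
  then show ?thesis by blast
qed

text \<open>Otherwise the nonnegative function z - 1 - ln z has integral 0 against
  \<open>f0\<close>, so z = 1 almost everywhere. Total mass at most 1 is enough, because missing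
  mass only lowers the integral.\<close>

lemma gibbs_strict:
  assumes [measurable]: "F \<in> borel_measurable borel"
    and cont: "continuous_on UNIV F"
    and F: "\<And>x. 0 \<le> F x" "\<And>x. F x \<le> c" "integrable lborel F" "(\<integral>x. F x \<partial>lborel) \<le> 1"
    and ne: "F \<noteq> f0"
  shows "(\<integral>x. f0 x * ln ((F x + f0 x) / (2 * f0 x)) \<partial>lborel) < 0"
proof (rule ccontr)
  define z where "z = (\<lambda>x. (F x + f0 x) / (2 * f0 x))"
  have [measurable]: "z \<in> borel_measurable borel" unfolding z_def by measurable
  assume "\<not> ?thesis"
  then have ge: "0 \<le> (\<integral>x. f0 x * ln (z x) \<partial>lborel)" by (simp add: z_def)
  have z: "z x > 0" for x using f0_pos[of x] F(1)[of x] by (simp add: z_def)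
  have c: "c \<ge> 0" using F(1,2) order_trans by blast
  obtain C where C: "\<And>x y. 0 \<le> y \<Longrightarrow> y \<le> c \<Longrightarrow> \<bar>ln ((y + f0 x) / (2 * f0 x))\<bar> \<le> C * (1 + x\<^sup>2)"
    using ln_average_bound[OF c] by blast
  have int1: "integrable lborel (\<lambda>x. f0 x * ln (z x))"
    by (rule integrable_f0_mult(1)[where C = C]) (use C F(1,2) in \<open>auto simp: z_def\<close>)
  \<comment> \<open>The factor \<open>f0\<close> cancels the denominator of z, so the linear part
    integrates to half of the mass of \<open>F\<close> minus 1.\<close>
  have eq: "f0 x * (z x - 1 - ln (z x)) = (F x - f0 x) / 2 - f0 x * ln (z x)" for x
    using f0_pos[of x] by (simp add: z_def field_simps)
  have int: "integrable lborel (\<lambda>x. f0 x * (z x - 1 - ln (z x)))"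
    unfolding eq using F(3) integrable_f0 int1 by simp
  have "(\<integral>x. f0 x * (z x - 1 - ln (z x)) \<partial>lborel) = ((\<integral>x. F x \<partial>lborel) - 1) / 2 - (\<integral>x. f0 x * ln (z x) \<partial>lborel)"
    unfolding eq using F(3) integrable_f0 int1 by (simp add: integral_f0)
  then have le0: "(\<integral>x. f0 x * (z x - 1 - ln (z x)) \<partial>lborel) \<le> 0"
    using F(4) ge by simp
  have nonneg: "0 \<le> f0 x * (z x - 1 - ln (z x))" for x
    using ln_le_minus_one[OF z[of x]] f0_pos[of x] by simp
  then have "(\<integral>x. f0 x * (z x - 1 - ln (z x)) \<partial>lborel) = 0"
    using le0 by (intro antisym integral_nonneg_AE AE_I2) auto
  then have "AE x in lborel. f0 x * (z x - 1 - ln (z x)) = 0"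
    using integral_nonneg_eq_0_iff_AE[OF int] nonneg by simp
  then have "AE x in lborel. F x = f0 x"
  proof eventually_elim
    case (elim x)
    then have "ln (z x) = z x - 1" using f0_pos[of x] by simp
    then have "z x = 1" by (intro ln_eq_minus_one z)
    then show "F x = f0 x" using f0_pos[of x] by (simp add: z_def field_simps)
  qed
  then have AE_eq: "AE x in lborel. F x = f0 x" .
  \<comment> \<open>Continuity turns equality almost everywhere into a contradiction: a difference
    at one point persists on an interval of positive length.\<close>
  obtain x0 where x0: "F x0 \<noteq> f0 x0" using ne by blast
  have cf0: "continuous_on UNIV f0"
    unfolding f0_eq[abs_def] normal_density_def by (intro continuous_intros) auto
  have "open {x. F x \<noteq> f0 x}"
    by (intro open_Collect_neq cont cf0)
  then obtain r where r: "r > 0" "cball x0 r \<subseteq> {x. F x \<noteq> f0 x}"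
    using x0 unfolding open_contains_cball by blast
  from AE_eq have "AE x in lborel. x \<notin> {x0 - r .. x0 + r}"
  proof eventually_elim
    case (elim x)
    then show ?case using r(2) unfolding cball_eq_atLeastAtMost by blast
  qed
  then have "{x0 - r .. x0 + r} \<in> null_sets lborel"
    by (subst AE_iff_null_sets) auto
  then have "emeasure lborel {x0 - r .. x0 + r} = 0" by auto
  then show False using r(1) by simp
qed

end

context gaussian_mixture_sample
begin

text \<open>The estimate is uniform in \<open>m\<close> and \<open>t\<close> because the exceptional
  events \<open>A1\<close> and \<open>A2\<close> concern sums of two fixed functions of the
  observations. The component enters only through its window count, which \<open>scattered\<close>
  controls for all centres and all small widths at once.\<close>

lemma narrow_components:
  assumes lam: "filterlim (\<lambda>n. real n * lam n) at_top sequentially" and e: "e > 0"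
  shows "\<exists>T. asymp_null M (\<lambda>n. {\<omega> \<in> space M. scattered N n \<omega> \<and>
      (\<exists>m t. t \<le> - T \<and> (\<Sum>i<n. ln (1 + gauss m t (X i \<omega>) / f0 (X i \<omega>)))
          > real n * e + real n * lam n / 2 * t\<^sup>2)})"
proof -
  obtain R :: nat where R: "(\<integral>x. f0 x * max 0 (ln (1 + 1 / f0 x) - real R) \<partial>lborel) < e / 8"
    using mean_tail_small[of "e / 8"] e by auto
  obtain T1 :: nat where T1: "(\<integral>x. f0 x * ln (1 + 8 * exp (- real T1) / f0 x) \<partial>lborel) < e / 8"
    using mean_background_small[of "e / 8"] e by auto
  have "((\<lambda>s. exp ((- s + 1) / 8) * (s + real R)) \<longlongrightarrow> 0) at_top" by real_asymp
  then have "\<forall>\<^sub>F s in at_top. exp ((- s + 1) / 8) * (s + real R) < e / 4"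
    by (rule order_tendstoD(2)) (use e in simp)
  then obtain S where S: "\<And>s. s \<ge> S \<Longrightarrow> exp ((- s + 1) / 8) * (s + real R) < e / 4"
    by (auto simp: eventually_at_top_linorder)
  \<comment> \<open>\<open>T1\<close> makes the outside contribution small, \<open>N\<close> makes
    the window count available, \<open>S\<close> makes count times cost small, and 1 ensures that
    both -t and 1 are at most t^2.\<close>
  define T where "T = max (max (real T1) (real N)) (max 1 S)"
  define g1 where "g1 = (\<lambda>x. max 0 (ln (1 + 1 / f0 x) - real R))"
  define g2 where "g2 = (\<lambda>x. ln (1 + 8 * exp (- real T1) / f0 x))"
  define A1 where "A1 = (\<lambda>n. {\<omega> \<in> space M. (\<Sum>i<n. g1 (X i \<omega>)) > n * ((\<integral>x. f0 x * g1 x \<partial>lborel) + e / 8)})"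
  define A2 where "A2 = (\<lambda>n. {\<omega> \<in> space M. (\<Sum>i<n. g2 (X i \<omega>)) > n * ((\<integral>x. f0 x * g2 x \<partial>lborel) + e / 8)})"
  have "asymp_null M A1"
  proof -
    obtain C where C: "C \<ge> 0" "\<And>x. ln (1 + 1 / f0 x) \<le> C * (1 + x\<^sup>2)"
      using ln_inverse_f0_bound by blast
    have "0 \<le> C * (1 + x\<^sup>2)" for x using C(1) by simp
    then have "\<bar>g1 x\<bar> \<le> C * (1 + x\<^sup>2)" for x using C(2)[of x] by (simp add: g1_def)
    then show ?thesis unfolding A1_def using e by (intro weak_law) (auto simp: g1_def)
  qed
  moreover have "asymp_null M A2"
  proof -
    obtain C where C: "C \<ge> 0" "\<And>x. ln (1 + 8 * exp (- real T1) / f0 x) \<le> C * (1 + x\<^sup>2)"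
      using ln_ratio_bound[of "8 * exp (- real T1)"] by auto
    have "g2 x \<ge> 0" for x
      unfolding g2_def using f0_pos[of x] by (intro ln_ge_zero) auto
    then have "\<bar>g2 x\<bar> \<le> C * (1 + x\<^sup>2)" for x using C(2)[of x] by (simp add: g2_def)
    then show ?thesis unfolding A2_def using e by (intro weak_law) (auto simp: g2_def)
  qed
  ultimately have null: "asymp_null M (\<lambda>n. A1 n \<union> A2 n)" by (rule asymp_null_Un)
  \<comment> \<open>From here on half of the penalty pays for the one observation that any window
    may contain: its cost -t + R is at most (1 + R) t^2 for t \<le> -1.\<close>
  have "\<forall>\<^sub>F n in sequentially. real n * lam n \<ge> 2 * (1 + real R)"
    using lam by (rule filterlim_at_top[THEN iffD1, rule_format])
  then have "\<forall>\<^sub>F n in sequentially. {\<omega> \<in> space M. scattered N n \<omega> \<and>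
      (\<exists>m t. t \<le> - T \<and> (\<Sum>i<n. ln (1 + gauss m t (X i \<omega>) / f0 (X i \<omega>)))
          > real n * e + real n * lam n / 2 * t\<^sup>2)} \<subseteq> A1 n \<union> A2 n"
  proof eventually_elim
    case (elim n)
    have "(\<Sum>i<n. ln (1 + gauss m t (X i \<omega>) / f0 (X i \<omega>))) \<le> real n * e + real n * lam n / 2 * t\<^sup>2"
      if \<omega>: "\<omega> \<in> space M" "scattered N n \<omega>" "\<omega> \<notin> A1 n \<union> A2 n" and t: "t \<le> - T" for \<omega> m t
    proof -
      define K where "K = real (card {i. i < n \<and> \<bar>X i \<omega> - m\<bar> \<le> exp (t / 2)})"
      have tT: "t \<le> - real T1" "t \<le> - real N" "t \<le> -1" "-t \<ge> S" using t by (auto simp: T_def)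
      have "ln (1 + gauss m t (X i \<omega>) / f0 (X i \<omega>)) \<le> g2 (X i \<omega>) + g1 (X i \<omega>)
          + (if \<bar>X i \<omega> - m\<bar> \<le> exp (t / 2) then - t + R else 0)" for i
        unfolding g1_def g2_def using tT by (intro ln_narrow_le) auto
      then have "(\<Sum>i<n. ln (1 + gauss m t (X i \<omega>) / f0 (X i \<omega>)))
          \<le> (\<Sum>i<n. g2 (X i \<omega>) + g1 (X i \<omega>) + (if \<bar>X i \<omega> - m\<bar> \<le> exp (t / 2) then - t + R else 0))"
        by (intro sum_mono)
      also have "\<dots> = (\<Sum>i<n. g2 (X i \<omega>)) + (\<Sum>i<n. g1 (X i \<omega>))
          + (\<Sum>i<n. if \<bar>X i \<omega> - m\<bar> \<le> exp (t / 2) then - t + R else 0)"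
        by (simp add: sum.distrib)
      also have "(\<Sum>i<n. if \<bar>X i \<omega> - m\<bar> \<le> exp (t / 2) then - t + R else 0) = K * (- t + R)"
        by (subst sum.inter_filter[symmetric]) (auto simp: K_def lessThan_def intro!: arg_cong[where f = card])
      also have "(\<Sum>i<n. g2 (X i \<omega>)) \<le> n * (e / 4)"
      proof -
        have "(\<Sum>i<n. g2 (X i \<omega>)) \<le> n * ((\<integral>x. f0 x * g2 x \<partial>lborel) + e / 8)"
          using \<omega> by (simp add: A2_def)
        also have "\<dots> \<le> n * (e / 4)" using T1 unfolding g2_def by (intro mult_left_mono) auto
        finally show ?thesis .
      qed
      also have "(\<Sum>i<n. g1 (X i \<omega>)) \<le> n * (e / 4)"
      proof -
        have "(\<Sum>i<n. g1 (X i \<omega>)) \<le> n * ((\<integral>x. f0 x * g1 x \<partial>lborel) + e / 8)"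
          using \<omega> by (simp add: A1_def)
        also have "\<dots> \<le> n * (e / 4)" using R unfolding g1_def by (intro mult_left_mono) auto
        finally show ?thesis .
      qed
      also have "K * (- t + R) \<le> n * (e / 4) + real n * lam n / 2 * t\<^sup>2"
      proof -
        have "K * (- t + R) \<le> (1 + n * exp ((t + 1) / 8)) * (- t + R)"
          unfolding K_def using tT by (intro mult_right_mono scattered_window[OF \<omega>(2)]) auto
        also have "\<dots> = (- t + R) + n * (exp ((t + 1) / 8) * (- t + R))"
          by (simp add: algebra_simps)
        also have "n * (exp ((t + 1) / 8) * (- t + R)) \<le> n * (e / 4)"
          using S[OF tT(4)] by (intro mult_left_mono) auto
        also have "- t + R \<le> (1 + R) * t\<^sup>2"
        proof -
          have "- t \<le> t\<^sup>2" using tT(3) self_le_power[of "-t" 2] by simp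
          moreover have "1 \<le> t\<^sup>2" using tT(3) one_le_power[of "-t" 2] by simp
          then have "real R * 1 \<le> R * t\<^sup>2" by (intro mult_left_mono) auto
          ultimately show ?thesis by (simp add: distrib_right)
        qed
        also have "(1 + R) * t\<^sup>2 \<le> real n * lam n / 2 * t\<^sup>2"
          using elim by (intro mult_right_mono) auto
        finally show ?thesis by simp
      qed
      finally have "(\<Sum>i<n. ln (1 + gauss m t (X i \<omega>) / f0 (X i \<omega>)))
          \<le> n * (e / 4) + n * (e / 4) + (n * (e / 4) + real n * lam n / 2 * t\<^sup>2)" by simp
      also have "\<dots> \<le> real n * e + real n * lam n / 2 * t\<^sup>2"
        using e by (simp add: field_simps)
      finally show ?thesis .
    qed
    then show ?case by (auto simp: not_less[symmetric])
  qed
  then show ?thesis by (intro exI[of _ T]) (rule asymp_null_mono[OF null])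
qed

end

section \<open>Compactification and consistency\<close>

lemma eventually_tanh_near:
  assumes "\<bar>b\<bar> < 1" "r > 0"
  shows "\<forall>\<^sub>F z in nhds b. \<forall>t::real. tanh t = z \<longrightarrow> \<bar>t - artanh b\<bar> < r"
proof -
  have "isCont artanh b" using assms(1) by (intro isCont_artanh) (auto simp: abs_less_iff)
  then have "(artanh \<longlongrightarrow> artanh b) (nhds b)"
    by (simp add: isCont_def tendsto_at_iff_tendsto_nhds)
  then have "\<forall>\<^sub>F z in nhds b. dist (artanh z) (artanh b) < r"
    using assms(2) by (rule tendstoD)
  then show ?thesis
    by eventually_elim (auto simp: artanh_tanh_real dist_real_def)
qed

lemma eventually_tanh_ge: "\<forall>\<^sub>F z in nhds 1. \<forall>t::real. tanh t = z \<longrightarrow> s \<le> t"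
proof -
  have "\<forall>\<^sub>F z in nhds 1. tanh s < z"
    by (rule order_tendstoD(1)[OF filterlim_ident tanh_real_lt_1])
  then show ?thesis by eventually_elim auto
qed

lemma eventually_tanh_le: "\<forall>\<^sub>F z in nhds (-1). \<forall>t::real. tanh t = z \<longrightarrow> t \<le> s"
proof -
  have "\<forall>\<^sub>F z in nhds (-1). z < tanh s"
    by (rule order_tendstoD(2)[OF filterlim_ident tanh_real_gt_neg1])
  then show ?thesis by eventually_elim auto
qed

lemma eventually_nhds_fst: "eventually P (nhds a) \<Longrightarrow> \<forall>\<^sub>F z in nhds (a, b). P (fst z)"
  using tendsto_fst[OF filterlim_ident, of "(a, b)"] by (simp add: filterlim_iff)

lemma eventually_nhds_snd: "eventually P (nhds b) \<Longrightarrow> \<forall>\<^sub>F z in nhds (a, b). P (snd z)"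
  using tendsto_snd[OF filterlim_ident, of "(a, b)"] by (simp add: filterlim_iff)

text \<open>The bounds \<open>u N\<close> hold on neighbourhoods of the point \<open>(a, b)\<close> that shrink with \<open>N\<close>; points
  with \<open>\<bar>a\<bar> = 1\<close> or \<open>\<bar>b\<bar> = 1\<close> stand for infinite means or log standard deviations.\<close>

definition envelope :: "real \<Rightarrow> real \<Rightarrow> (nat \<Rightarrow> real \<Rightarrow> real) \<Rightarrow> (real \<Rightarrow> real) \<Rightarrow> real \<Rightarrow> bool" where
  "envelope a b u v c \<longleftrightarrow>
     (\<forall>N. u N \<in> borel_measurable borel) \<and> (\<forall>N x. 0 \<le> u N x \<and> u N x \<le> c) \<and>
     (\<forall>x. (\<lambda>N. u N x) \<longlonglongrightarrow> v x) \<and>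
     (\<forall>N. \<forall>\<^sub>F z in nhds (a, b). \<forall>m t. tanh m = fst z \<and> tanh t = snd z \<longrightarrow> (\<forall>x. gauss m t x \<le> u N x))"

lemma gauss_envelope_bounds:
  "0 \<le> exp (-s) / sqrt (2 * pi) * exp (- d\<^sup>2 / (2 * exp (2 * s')))"
  "exp (-s) / sqrt (2 * pi) * exp (- d\<^sup>2 / (2 * exp (2 * s'))) \<le> exp (-s)"
proof -
  have "exp (-s) / sqrt (2 * pi) \<le> exp (-s) / 1"
    using pi_gt3 by (intro divide_left_mono) auto
  moreover have "exp (-s) / sqrt (2 * pi) * exp (- d\<^sup>2 / (2 * exp (2 * s'))) \<le> exp (-s) / sqrt (2 * pi) * 1"
    by (intro mult_left_mono) auto
  ultimately show "exp (-s) / sqrt (2 * pi) * exp (- d\<^sup>2 / (2 * exp (2 * s'))) \<le> exp (-s)" by simp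
qed simp

text \<open>A component that flattens out, or whose mean escapes at bounded width, disappears in the
  limit; one with finite limits converges. The value \<open>b = -1\<close> is excluded because
  densities of vanishing width have no common bound.\<close>

lemma envelope_exists:
  assumes "\<bar>a\<bar> \<le> 1" "\<bar>b\<bar> \<le> 1" "b \<noteq> -1"
  shows "\<exists>u c. envelope a b u (if \<bar>a\<bar> < 1 \<and> \<bar>b\<bar> < 1 then gauss (artanh a) (artanh b) else (\<lambda>_. 0)) c"
proof -
  define s where "s = artanh b"
  consider "b = 1" | "\<bar>b\<bar> < 1" "\<bar>a\<bar> = 1" | "\<bar>b\<bar> < 1" "\<bar>a\<bar> < 1"
    using assms by linarith
  then show ?thesis
  proof cases
    case 1
    have "(\<lambda>N. exp (- real N)) \<longlonglongrightarrow> 0" by real_asymp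
    moreover have "\<forall>\<^sub>F z in nhds (a, b). \<forall>m t. tanh m = fst z \<and> tanh t = snd z \<longrightarrow>
        (\<forall>x. gauss m t x \<le> exp (- real N))" for N
      using eventually_nhds_snd[OF eventually_tanh_ge[of "real N"], of a] unfolding 1
      by eventually_elim (auto intro: gauss_le)
    ultimately have "envelope a b (\<lambda>N x. exp (- real N)) (\<lambda>_. 0) 1"
      by (simp add: envelope_def)
    then show ?thesis using 1 by auto
  next
    case 2
    \<comment> \<open>If the mean has absolute value at least N, its distance from x is at least N -
      abs x. The log standard deviation is only known up to 1, hence s - 1 in the prefactor and s +
      1 in the exponent.\<close>
    define u where "u = (\<lambda>(N::nat) x. exp (- (s - 1)) / sqrt (2 * pi)
        * exp (- (max 0 (real N - \<bar>x\<bar>))\<^sup>2 / (2 * exp (2 * (s + 1)))))"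
    have "u N \<in> borel_measurable borel" for N unfolding u_def by measurable
    moreover have "0 \<le> u N x \<and> u N x \<le> exp (- (s - 1))" for N x
      unfolding u_def using gauss_envelope_bounds by blast
    moreover have "(\<lambda>N. u N x) \<longlonglongrightarrow> 0" for x
    proof -
      define A where "A = 2 * exp (2 * (s + 1))"
      have A: "A > 0" by (simp add: A_def)
      have "(\<lambda>N. exp (- (real N - \<bar>x\<bar>)\<^sup>2 / A)) \<longlonglongrightarrow> 0" using A by real_asymp
      moreover have "\<forall>\<^sub>F N in sequentially. real N \<ge> \<bar>x\<bar>"
        using filterlim_real_sequentially by (rule filterlim_at_top[THEN iffD1, rule_format])
      then have "\<forall>\<^sub>F N in sequentially. exp (- (real N - \<bar>x\<bar>)\<^sup>2 / A) = exp (- (max 0 (real N - \<bar>x\<bar>))\<^sup>2 / A)"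
        by eventually_elim simp
      ultimately have "(\<lambda>N. exp (- (max 0 (real N - \<bar>x\<bar>))\<^sup>2 / A)) \<longlonglongrightarrow> 0"
        by (rule Lim_transform_eventually)
      then show ?thesis unfolding u_def A_def[symmetric] by (rule tendsto_mult_right_zero)
    qed
    moreover have "\<forall>\<^sub>F z in nhds (a, b). \<forall>m t. tanh m = fst z \<and> tanh t = snd z \<longrightarrow>
        (\<forall>x. gauss m t x \<le> u N x)" for N
    proof -
      have "\<forall>\<^sub>F z in nhds a. \<forall>m. tanh m = z \<longrightarrow> real N \<le> \<bar>m\<bar>"
      proof (cases "a = 1")
        case True
        then show ?thesis
          using eventually_tanh_ge[of "real N"] by (auto elim!: eventually_mono)
      next
        case False
        then have "a = -1" using 2 by linarith
        then show ?thesis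
          using eventually_tanh_le[of "- real N"] by (auto elim!: eventually_mono)
      qed
      from eventually_nhds_fst[OF this, of b]
        eventually_nhds_snd[OF eventually_tanh_near[OF 2(1) zero_less_one], of a]
      show ?thesis
      proof eventually_elim
        case (elim z)
        show ?case
        proof (intro allI impI)
          fix m t x assume mt: "tanh m = fst z \<and> tanh t = snd z"
          then have "real N \<le> \<bar>m\<bar>" "\<bar>t - s\<bar> < 1" using elim by (auto simp: s_def)
          then show "gauss m t x \<le> u N x"
            unfolding u_def by (intro gauss_le_envelope) auto
        qed
      qed
    qed
    ultimately have "envelope a b u (\<lambda>_. 0) (exp (- (s - 1)))"
      by (simp add: envelope_def)
    then show ?thesis using 2 by auto
  next
    case 3
    define w where "w = artanh a"
    define r where "r = (\<lambda>N::nat. 1 / (real N + 1))"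
    have r: "r N > 0" "r N \<le> 1" for N by (auto simp: r_def)
    \<comment> \<open>If the mean is within \<open>r N\<close> of w, its distance from x is at least
      that of w minus \<open>r N\<close>; cutting at 0 keeps this a valid lower bound near
      w.\<close>
    define u where "u = (\<lambda>(N::nat) x. exp (- (s - r N)) / sqrt (2 * pi)
        * exp (- (max 0 (\<bar>x - w\<bar> - r N))\<^sup>2 / (2 * exp (2 * (s + r N)))))"
    have "u N \<in> borel_measurable borel" for N unfolding u_def by measurable
    moreover have "0 \<le> u N x \<and> u N x \<le> exp (- (s - 1))" for N x
    proof -
      have "exp (- (s - r N)) \<le> exp (- (s - 1))" using r(2)[of N] by simp
      then show ?thesis unfolding u_def using gauss_envelope_bounds order_trans by blast
    qed
    moreover have "(\<lambda>N. u N x) \<longlonglongrightarrow> gauss w s x" for x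
    proof -
      have "r \<longlonglongrightarrow> 0" unfolding r_def by real_asymp
      then have "(\<lambda>N. u N x) \<longlonglongrightarrow> exp (- (s - 0)) / sqrt (2 * pi)
          * exp (- (max 0 (\<bar>x - w\<bar> - 0))\<^sup>2 / (2 * exp (2 * (s + 0))))"
        unfolding u_def by (intro tendsto_intros) auto
      then show ?thesis by (simp add: gauss_eq)
    qed
    moreover have "\<forall>\<^sub>F z in nhds (a, b). \<forall>m t. tanh m = fst z \<and> tanh t = snd z \<longrightarrow>
        (\<forall>x. gauss m t x \<le> u N x)" for N
      using eventually_nhds_fst[OF eventually_tanh_near[OF 3(2) r(1)[of N]], of b]
        eventually_nhds_snd[OF eventually_tanh_near[OF 3(1) r(1)[of N]], of a]
    proof eventually_elim
      case (elim z)
      show ?case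
      proof (intro allI impI)
        fix m t x assume mt: "tanh m = fst z \<and> tanh t = snd z"
        then have "\<bar>m - w\<bar> < r N" "\<bar>t - s\<bar> < r N" using elim by (auto simp: s_def w_def)
        then show "gauss m t x \<le> u N x"
          unfolding u_def by (intro gauss_le_envelope) auto
      qed
    qed
    ultimately have "envelope a b u (gauss w s) (exp (- (s - 1)))"
      by (simp add: envelope_def)
    then show ?thesis using 3 by (auto simp: w_def s_def)
  qed
qed

section \<open>The compactified parameter space\<close>

definition compactify :: "'k::finite param \<Rightarrow> 'k param" where
  "compactify = (\<lambda>(p, m, t). (p, (\<chi> j. tanh (m $ j)), (\<chi> j. tanh (t $ j))))"

text \<open>\<open>Theta\<close> constrains only the weights, so it can be reused for triples whose
  other entries are transformed coordinates. The closed bounds add the ideal points that stand for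
  infinite means and log standard deviations.\<close>

definition compact_params :: "'k::finite param set" where
  "compact_params = {(p, a, b). (p, a, b) \<in> Theta \<and> (\<forall>j. \<bar>a $ j\<bar> \<le> 1 \<and> \<bar>b $ j\<bar> \<le> 1)}"

lemma compactify_in: "\<theta> \<in> Theta \<Longrightarrow> compactify \<theta> \<in> compact_params"
  using tanh_real_lt_1 tanh_real_gt_neg1
  by (auto simp: compactify_def compact_params_def Theta_def abs_le_iff less_imp_le minus_le_iff)

lemma compact_compact_params: "compact (compact_params :: 'k::finite param set)"
proof -
  have "compact_params = Theta \<inter> (\<Inter>j. {z :: 'k param. \<bar>fst (snd z) $ j\<bar> \<le> 1})
      \<inter> (\<Inter>j. {z. \<bar>snd (snd z) $ j\<bar> \<le> 1})"
    by (auto simp: compact_params_def)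
  moreover have "closed \<dots>"
    by (intro closed_Int closed_Theta closed_INT ballI closed_Collect_le continuous_intros)
  ultimately have "closed (compact_params :: 'k param set)" by simp
  moreover have "bounded (compact_params :: 'k param set)"
  proof (rule boundedI)
    fix \<theta> :: "'k param" assume "\<theta> \<in> compact_params"
    then obtain p a b where \<theta>: "\<theta> = (p, a, b)" "\<And>j. \<bar>p $ j\<bar> \<le> 1" "\<And>j. \<bar>a $ j\<bar> \<le> 1" "\<And>j. \<bar>b $ j\<bar> \<le> 1"
      by (auto simp: compact_params_def Theta_def)
    have unit: "norm w \<le> real CARD('k)" if "\<And>j. \<bar>w $ j\<bar> \<le> 1" for w :: "real ^ 'k"
    proof -
      have "norm w \<le> (\<Sum>j\<in>UNIV. \<bar>w $ j\<bar>)" by (rule norm_le_l1_cart)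
      also have "\<dots> \<le> (\<Sum>j\<in>(UNIV::'k set). 1)" using that by (intro sum_mono)
      finally show ?thesis by simp
    qed
    have "norm \<theta> \<le> norm p + norm (a, b)" unfolding \<theta>(1) by (rule norm_Pair_le)
    also have "\<dots> \<le> norm p + (norm a + norm b)" using norm_Pair_le by (rule add_left_mono)
    also have "\<dots> \<le> real CARD('k) + (real CARD('k) + real CARD('k))"
      using \<theta>(2-4) by (intro add_mono unit)
    finally show "norm \<theta> \<le> real CARD('k) + (real CARD('k) + real CARD('k))" .
  qed
  ultimately show ?thesis by (simp add: compact_eq_bounded_closed)
qed

text \<open>Applying artanh coordinatewise inverts \<open>compactify\<close> and is continuous at
  interior points, so closeness after compactification gives closeness of the original parameters to
  an orbit point.\<close>

lemma orbit_neighbourhood: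
  fixes p a b :: "real ^ 'k::finite"
  assumes ab: "\<And>j. \<bar>a $ j\<bar> < 1" "\<And>j. \<bar>b $ j\<bar> < 1"
    and \<tau>: "\<tau> permutes UNIV" "perm_act \<tau> \<theta>0 = (p, (\<chi> j. artanh (a $ j)), (\<chi> j. artanh (b $ j)))"
    and e: "e > 0"
  shows "\<exists>U. open U \<and> (p, a, b) \<in> U \<and> (\<forall>\<theta>. compactify \<theta> \<in> U \<longrightarrow> orbit_dist \<theta> \<theta>0 \<le> e)"
proof -
  define G where "G = (\<lambda>z :: 'k param. (fst z, (\<chi> j. artanh (fst (snd z) $ j)), (\<chi> j. artanh (snd (snd z) $ j))))"
  have G: "G (compactify \<theta>) = \<theta>" for \<theta>
    by (cases \<theta>) (simp add: G_def compactify_def artanh_tanh_real vec_eq_iff)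
  have "(G \<longlongrightarrow> G (p, a, b)) (nhds (p, a, b))"
    unfolding G_def using ab
    by (intro tendsto_Pair vec_tendstoI) (auto simp: abs_less_iff intro!: tendsto_eq_intros filterlim_ident)
  then have "\<forall>\<^sub>F z in nhds (p, a, b). dist (G z) (G (p, a, b)) < e"
    using e by (rule tendstoD)
  then obtain U where U: "open U" "(p, a, b) \<in> U" "\<And>z. z \<in> U \<Longrightarrow> dist (G z) (G (p, a, b)) < e"
    unfolding eventually_nhds by blast
  have "orbit_dist \<theta> \<theta>0 \<le> e" if "compactify \<theta> \<in> U" for \<theta>
  proof -
    have "norm (\<theta> - perm_act \<tau> \<theta>0) < e"
      using U(3)[OF that] unfolding G by (simp add: dist_norm \<tau>(2) G_def)
    then show ?thesis using orbit_dist_le[OF \<tau>(1), of \<theta> \<theta>0] by linarith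
  qed
  then show ?thesis using U by blast
qed

text \<open>The product of the factors 1 + a_j expands to at least 1 plus the sum.\<close>

lemma ln_one_plus_sum_le:
  assumes "finite A" "\<And>j. j \<in> A \<Longrightarrow> 0 \<le> a j"
  shows "ln (1 + (\<Sum>j\<in>A. a j)) \<le> (\<Sum>j\<in>A. ln (1 + a j :: real))"
  using assms
proof (induction A rule: finite_induct)
  case (insert i A)
  have s: "0 \<le> (\<Sum>j\<in>A. a j)" using insert by (intro sum_nonneg) auto
  have i: "0 \<le> a i" using insert by auto
  have "ln (1 + (\<Sum>j\<in>insert i A. a j)) \<le> ln ((1 + a i) * (1 + (\<Sum>j\<in>A. a j)))"
    using insert s i by (intro ln_mono) (auto simp: algebra_simps intro: add_pos_nonneg)
  also have "\<dots> = ln (1 + a i) + ln (1 + (\<Sum>j\<in>A. a j))"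
    using s i by (intro ln_mult_pos) auto
  finally show ?case using insert by simp
qed simp

context gaussian_mixture
begin

text \<open>Passing to the average of \<open>f\<^sub>\<theta>\<close> and \<open>f\<^sub>0\<close> bounds the log-ratio from below,
  and then each narrow component splits off as a separate summand.\<close>

lemma half_log_ratio_le:
  assumes \<theta>: "(q, m, t) \<in> Theta"
    and F: "(\<Sum>j\<in>- A. q $ j * gauss (m $ j) (t $ j) x) \<le> F"
  shows "(ln (mix_density (q, m, t) x) - ln (f0 x)) / 2
      \<le> ln ((F + f0 x) / (2 * f0 x)) + (\<Sum>j\<in>A. ln (1 + gauss (m $ j) (t $ j) x / f0 x))"
proof -
  define f where "f = mix_density (q, m, t) x"
  define S where "S = (\<Sum>j\<in>A. gauss (m $ j) (t $ j) x / f0 x)"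
  have q: "0 \<le> q $ j" "q $ j \<le> 1" for j using \<theta> by (auto simp: Theta_def)
  have f: "f > 0" unfolding f_def by (rule mix_density_pos[OF \<theta>])
  have f0: "f0 x > 0" by (rule f0_pos)
  have S: "S \<ge> 0" unfolding S_def using f0 by (intro sum_nonneg) auto
  have "0 \<le> (\<Sum>j\<in>- A. q $ j * gauss (m $ j) (t $ j) x)"
    using q by (intro sum_nonneg) auto
  then have F0: "F \<ge> 0" using F by linarith
  have "f = (\<Sum>j\<in>- A. q $ j * gauss (m $ j) (t $ j) x) + (\<Sum>j\<in>A. q $ j * gauss (m $ j) (t $ j) x)"
    unfolding f_def mix_density_eq
    by (subst sum.union_disjoint[symmetric]) (auto simp: Un_commute Compl_partition)
  also have "(\<Sum>j\<in>A. q $ j * gauss (m $ j) (t $ j) x) \<le> f0 x * S"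
    unfolding S_def sum_distrib_left using q f0 by (intro sum_mono) (auto intro: mult_left_le_one_le)
  finally have "f \<le> F + f0 x * S" using F by linarith
  then have "(f + f0 x) / (2 * f0 x) \<le> (F + f0 x * S + f0 x) / (2 * f0 x)"
    using f0 by (intro divide_right_mono) auto
  also have "\<dots> \<le> (F + f0 x) / (2 * f0 x) * (1 + S)"
    using f0 F0 S by (simp add: field_simps)
  finally have le: "(f + f0 x) / (2 * f0 x) \<le> (F + f0 x) / (2 * f0 x) * (1 + S)" .
  have pos: "0 < (f + f0 x) / (2 * f0 x)" using f f0 by simp
  have "f / f0 x \<le> ((f + f0 x) / (2 * f0 x))\<^sup>2"
  proof -
    have "0 \<le> (f - f0 x)\<^sup>2 / (2 * f0 x)\<^sup>2" by simp
    also have "\<dots> = ((f + f0 x) / (2 * f0 x))\<^sup>2 - f / f0 x"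
      using f0 by (simp add: field_simps power2_eq_square)
    finally show ?thesis by simp
  qed
  then have "ln (f / f0 x) \<le> ln (((f + f0 x) / (2 * f0 x))\<^sup>2)"
    using f f0 by (intro ln_mono) auto
  then have "(ln f - ln (f0 x)) / 2 \<le> ln ((f + f0 x) / (2 * f0 x))"
    using f f0 pos by (simp add: ln_realpow ln_div)
  also have "\<dots> \<le> ln ((F + f0 x) / (2 * f0 x) * (1 + S))"
    using le pos by (rule ln_mono)
  also have "\<dots> = ln ((F + f0 x) / (2 * f0 x)) + ln (1 + S)"
    using F0 f0 S by (intro ln_mult_pos) (auto intro!: divide_pos_pos add_nonneg_pos)
  also have "ln (1 + S) \<le> (\<Sum>j\<in>A. ln (1 + gauss (m $ j) (t $ j) x / f0 x))"
    unfolding S_def using f0 by (intro ln_one_plus_sum_le) auto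
  finally show ?thesis by (simp add: f_def)
qed

end

section \<open>Excluding parameters away from the orbit\<close>

context gaussian_mixture_sample
begin

text \<open>The set \<open>U\<close> localizes the event for the covering argument, and
  \<open>UNIV\<close> recovers the global one. Being scattered is built in because the bound for
  narrow components presupposes it.\<close>

definition better_far :: "real \<Rightarrow> (nat \<Rightarrow> real) \<Rightarrow> nat \<Rightarrow> 'k param set \<Rightarrow> nat \<Rightarrow> 'a set" where
  "better_far e lam N U n = {\<omega> \<in> space M. scattered N n \<omega> \<and>
     (\<exists>\<theta>\<in>Theta. compactify \<theta> \<in> U \<and> e < orbit_dist \<theta> (p0, m0, t0) \<and>
       pen_log_lik (\<lambda>i. X i \<omega>) n (lam n) (p0, m0, t0) \<le> pen_log_lik (\<lambda>i. X i \<omega>) n (lam n) \<theta>)}"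

text \<open>Components with an infinite parameter drop out and leave a mixture of mass at most 1. If
  it equalled \<open>f0\<close>, identifiability would restore all indices and make the limit an
  orbit point, which \<open>far\<close> excludes.\<close>

lemma limit_mixture_divergence:
  fixes p a b :: "real ^ 'k"
  defines "G \<equiv> {j. \<bar>a $ j\<bar> < 1 \<and> \<bar>b $ j\<bar> < 1}"
  assumes p: "\<And>j. 0 \<le> p $ j" "(\<Sum>j\<in>UNIV. p $ j) = 1"
    and far: "\<not> (G = UNIV \<and> (\<exists>\<tau>. \<tau> permutes UNIV \<and>
        perm_act \<tau> (p0, m0, t0) = (p, (\<chi> j. artanh (a $ j)), (\<chi> j. artanh (b $ j)))))"
  shows "(\<integral>x. f0 x * ln (((\<Sum>j\<in>G. p $ j * gauss (artanh (a $ j)) (artanh (b $ j)) x) + f0 x) / (2 * f0 x)) \<partial>lborel) < 0"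
proof -
  define F where "F = (\<lambda>x. \<Sum>j\<in>G. p $ j * gauss (artanh (a $ j)) (artanh (b $ j)) x)"
  have "(\<integral>x. f0 x * ln ((F x + f0 x) / (2 * f0 x)) \<partial>lborel) < 0"
  proof (rule gibbs_strict[where c = "\<Sum>j\<in>G. p $ j * exp (- artanh (b $ j))"])
    show "continuous_on UNIV F"
      unfolding F_def normal_density_def by (intro continuous_intros) auto
    show "0 \<le> F x" for x
      unfolding F_def using p by (intro sum_nonneg) auto
    show "F x \<le> (\<Sum>j\<in>G. p $ j * exp (- artanh (b $ j)))" for x
      unfolding F_def using p by (intro sum_mono mult_left_mono gauss_le) auto
    have "(\<integral>x. F x \<partial>lborel) = (\<Sum>j\<in>G. p $ j)" unfolding F_def by simp
    also have "\<dots> \<le> (\<Sum>j\<in>UNIV. p $ j)" using p by (intro sum_mono2) auto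
    finally show "(\<integral>x. F x \<partial>lborel) \<le> 1" using p by simp
    show "F \<noteq> f0"
    proof
      assume "F = f0"
      then have "(\<Sum>j\<in>G. p $ j * gauss ((\<chi> j. artanh (a $ j)) $ j) ((\<chi> j. artanh (b $ j)) $ j) x)
          = (\<Sum>j\<in>UNIV. p0 $ j * gauss (m0 $ j) (t0 $ j) x)" for x
        unfolding F_def f0_eq[symmetric] by (simp add: fun_eq_iff)
      from gauss_mixture_identifiable[OF this weights_pos distinct_components] far
      show False by blast
    qed
  qed (simp_all add: F_def)
  then show ?thesis by (simp add: F_def)
qed

lemma better_far_away:
  fixes p a b :: "real ^ 'k"
  assumes lam: "\<And>n. lam n > 0" "lam \<longlonglongrightarrow> 0" "filterlim (\<lambda>n. real n * lam n) at_top sequentially"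
    and mem: "(p, a, b) \<in> compact_params"
    and far: "\<not> ({j. \<bar>a $ j\<bar> < 1 \<and> \<bar>b $ j\<bar> < 1} = UNIV \<and> (\<exists>\<tau>. \<tau> permutes UNIV \<and>
        perm_act \<tau> (p0, m0, t0) = (p, (\<chi> j. artanh (a $ j)), (\<chi> j. artanh (b $ j)))))"
  shows "\<exists>U. open U \<and> (p, a, b) \<in> U \<and> asymp_null M (better_far e lam N U)"
proof -
  have p: "0 \<le> p $ j" "(\<Sum>j\<in>UNIV. p $ j) = 1" and ab: "\<bar>a $ j\<bar> \<le> 1" "\<bar>b $ j\<bar> \<le> 1" for j
    using mem by (auto simp: compact_params_def Theta_def)
  define A where "A = {j. b $ j = -1}"
  define G where "G = {j. \<bar>a $ j\<bar> < 1 \<and> \<bar>b $ j\<bar> < 1}"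
  define v where "v = (\<lambda>j. if \<bar>a $ j\<bar> < 1 \<and> \<bar>b $ j\<bar> < 1 then gauss (artanh (a $ j)) (artanh (b $ j)) else (\<lambda>_. 0))"
  have "\<forall>j. \<exists>u c. j \<in> - A \<longrightarrow> envelope (a $ j) (b $ j) u (v j) c"
    using envelope_exists[OF ab] unfolding v_def A_def by auto
  then obtain u c where env: "\<And>j. j \<in> - A \<Longrightarrow> envelope (a $ j) (b $ j) (u j) (v j) (c j)"
    by metis
  have u_meas [measurable]: "\<And>j r. j \<in> - A \<Longrightarrow> u j r \<in> borel_measurable borel"
    and u_bound: "\<And>j r x. j \<in> - A \<Longrightarrow> 0 \<le> u j r x \<and> u j r x \<le> c j"
    and u_lim: "\<And>j x. j \<in> - A \<Longrightarrow> (\<lambda>r. u j r x) \<longlonglongrightarrow> v j x"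
    and u_dom: "\<And>j r. j \<in> - A \<Longrightarrow> \<forall>\<^sub>F z in nhds (a $ j, b $ j). \<forall>m t. tanh m = fst z \<and> tanh t = snd z
        \<longrightarrow> (\<forall>x. gauss m t x \<le> u j r x)"
    using env unfolding envelope_def by blast+
  \<comment> \<open>The weights are raised by 1 / (r + 1) so that \<open>F r\<close> also dominates
    mixtures with slightly different weights; the increase vanishes in the limit.\<close>
  define F where "F = (\<lambda>(r::nat) x. \<Sum>j\<in>- A. (p $ j + 1 / (real r + 1)) * u j r x)"
  define F' where "F' = (\<lambda>x. \<Sum>j\<in>- A. p $ j * v j x)"
  have F'_eq: "F' x = (\<Sum>j\<in>G. p $ j * gauss (artanh (a $ j)) (artanh (b $ j)) x)" for x
    unfolding F'_def by (rule sum.mono_neutral_cong_right) (auto simp: G_def A_def v_def)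
  define B where "B = (\<Sum>j\<in>- A. (p $ j + 1) * c j)"
  have F_bound: "0 \<le> F r x" "F r x \<le> B" for r x
  proof -
    show "0 \<le> F r x"
      unfolding F_def using p u_bound by (intro sum_nonneg mult_nonneg_nonneg add_nonneg_nonneg) auto
    show "F r x \<le> B"
      unfolding F_def B_def using p u_bound
      by (intro sum_mono mult_mono add_left_mono add_nonneg_nonneg) (auto simp: field_simps)
  qed
  have F_lim: "(\<lambda>r. F r x) \<longlonglongrightarrow> F' x" for x
  proof -
    have "(\<lambda>r. 1 / (real r + 1)) \<longlonglongrightarrow> 0" by real_asymp
    then have "(\<lambda>r. F r x) \<longlonglongrightarrow> (\<Sum>j\<in>- A. (p $ j + 0) * v j x)"
      unfolding F_def by (intro tendsto_intros u_lim) auto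
    then show ?thesis by (simp add: F'_def)
  qed
  have F_meas [measurable]: "F r \<in> borel_measurable borel" for r
    unfolding F_def by (intro borel_measurable_sum borel_measurable_times u_meas) auto
  have F'_meas [measurable]: "F' \<in> borel_measurable borel"
    unfolding F'_eq[abs_def] by measurable
  have F'_nonneg: "0 \<le> F' x" for x
    unfolding F'_eq using p by (intro sum_nonneg) auto
  have B: "B \<ge> 0" using F_bound order_trans by blast
  define g where "g = (\<lambda>r x. ln ((F r x + f0 x) / (2 * f0 x)))"
  obtain C where C: "\<And>r x. \<bar>g r x\<bar> \<le> C * (1 + x\<^sup>2)"
    using ln_average_bound[OF B] F_bound unfolding g_def by blast
  define I where "I = (\<integral>x. f0 x * ln ((F' x + f0 x) / (2 * f0 x)) \<partial>lborel)"
  have I: "I < 0"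
    unfolding I_def F'_eq G_def by (rule limit_mixture_divergence[OF p far])
  \<comment> \<open>The budget per observation: the limit mean is -4 \<eta>, a good envelope has
    mean below -3 \<eta>, the weak law leaves -2 \<eta>, and all narrow components together use
    another \<eta>, that is \<eta> / k each. A deficit of \<eta> remains for half the
    log-ratio.\<close>
  define \<eta> where "\<eta> = - I / 4"
  have \<eta>: "\<eta> > 0" using I by (simp add: \<eta>_def)
  have g_meas [measurable]: "g r \<in> borel_measurable borel" for r unfolding g_def by measurable
  have "(\<lambda>r. \<integral>x. f0 x * g r x \<partial>lborel) \<longlonglongrightarrow> I"
    unfolding I_def
  proof (rule mean_tendsto[OF _ _ C])
    show "(\<lambda>r. g r x) \<longlonglongrightarrow> ln ((F' x + f0 x) / (2 * f0 x))" for x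
    proof -
      have "(F' x + f0 x) / (2 * f0 x) > 0"
        using f0_pos[of x] F'_nonneg[of x] by (intro divide_pos_pos) auto
      then show ?thesis
        unfolding g_def using f0_pos[of x] by (intro tendsto_intros F_lim) auto
    qed
  qed measurable
  then have "\<forall>\<^sub>F r in sequentially. (\<integral>x. f0 x * g r x \<partial>lborel) < - 3 * \<eta>"
    by (rule order_tendstoD(2)) (use I in \<open>simp add: \<eta>_def\<close>)
  then obtain r where r: "(\<integral>x. f0 x * g r x \<partial>lborel) < - 3 * \<eta>"
    by (auto simp: eventually_sequentially)
  define k where "k = real CARD('k)"
  have k: "k > 0" by (simp add: k_def)
  obtain T where T: "asymp_null M (\<lambda>n. {\<omega> \<in> space M. scattered N n \<omega> \<and>
      (\<exists>m t. t \<le> - T \<and> (\<Sum>i<n. ln (1 + gauss m t (X i \<omega>) / f0 (X i \<omega>)))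
          > real n * (\<eta> / k) + real n * lam n / 2 * t\<^sup>2)})"
    using narrow_components[OF lam(3), of "\<eta> / k" N] \<eta> k by auto
  define B1 where "B1 = (\<lambda>n. {\<omega> \<in> space M. scattered N n \<omega> \<and>
      (\<exists>m t. t \<le> - T \<and> (\<Sum>i<n. ln (1 + gauss m t (X i \<omega>) / f0 (X i \<omega>)))
          > real n * (\<eta> / k) + real n * lam n / 2 * t\<^sup>2)})"
  define B2 where "B2 = (\<lambda>n. {\<omega> \<in> space M. (\<Sum>i<n. g r (X i \<omega>)) > n * ((\<integral>x. f0 x * g r x \<partial>lborel) + \<eta>)})"
  have null: "asymp_null M (\<lambda>n. B1 n \<union> B2 n)"
    unfolding B1_def B2_def by (intro asymp_null_Un T weak_law[OF g_meas C \<eta>])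
  \<comment> \<open>\<open>P\<close> collects what the estimate needs near the limit point:
    envelopes for the components that do not collapse, weights below the raised ones, and width
    below the threshold \<open>T\<close> for those that collapse. Only finitely many indices occur,
    so these eventual statements can be joined.\<close>
  define P where "P = (\<lambda>z :: 'k param. (\<forall>j\<in>- A. \<forall>m t. tanh m = fst (snd z) $ j \<and> tanh t = snd (snd z) $ j
        \<longrightarrow> (\<forall>x. gauss m t x \<le> u j r x))
      \<and> (\<forall>j. fst z $ j < p $ j + 1 / (real r + 1))
      \<and> (\<forall>j\<in>A. \<forall>t. tanh t = snd (snd z) $ j \<longrightarrow> t \<le> - T))"
  have "eventually P (nhds (p, a, b))"
    unfolding P_def
  proof (intro eventually_conj eventually_ball_finite eventually_all_finite ballI)
    fix j assume "j \<in> - A"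
    have "((\<lambda>z :: 'k param. (fst (snd z) $ j, snd (snd z) $ j)) \<longlongrightarrow> (a $ j, b $ j)) (nhds (p, a, b))"
      by (auto intro!: tendsto_eq_intros filterlim_ident)
    from this[unfolded filterlim_iff, rule_format, OF u_dom[OF \<open>j \<in> - A\<close>]]
    show "\<forall>\<^sub>F z :: 'k param in nhds (p, a, b). \<forall>m t. tanh m = fst (snd z) $ j \<and> tanh t = snd (snd z) $ j
        \<longrightarrow> (\<forall>x. gauss m t x \<le> u j r x)" by simp
  next
    fix j
    have "((\<lambda>z :: 'k param. fst z $ j) \<longlongrightarrow> p $ j) (nhds (p, a, b))"
      by (auto intro!: tendsto_eq_intros filterlim_ident)
    then show "\<forall>\<^sub>F z :: 'k param in nhds (p, a, b). fst z $ j < p $ j + 1 / (real r + 1)"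
      by (rule order_tendstoD(2)) (simp add: add_pos_nonneg)
  next
    fix j assume "j \<in> A"
    have "((\<lambda>z :: 'k param. snd (snd z) $ j) \<longlongrightarrow> b $ j) (nhds (p, a, b))"
      by (auto intro!: tendsto_eq_intros filterlim_ident)
    then have "((\<lambda>z :: 'k param. snd (snd z) $ j) \<longlongrightarrow> -1) (nhds (p, a, b))"
      using \<open>j \<in> A\<close> by (simp add: A_def)
    from this[unfolded filterlim_iff, rule_format, OF eventually_tanh_le[of "- T"]]
    show "\<forall>\<^sub>F z :: 'k param in nhds (p, a, b). \<forall>t. tanh t = snd (snd z) $ j \<longrightarrow> t \<le> - T" .
  qed auto
  then obtain U where U: "open U" "(p, a, b) \<in> U" "\<And>z. z \<in> U \<Longrightarrow> P z"
    unfolding eventually_nhds by blast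
  have "(\<lambda>n. lam n * penalty (p0, m0, t0)) \<longlonglongrightarrow> 0 * penalty (p0, m0, t0)"
    by (intro tendsto_intros lam)
  then have "\<forall>\<^sub>F n in sequentially. lam n * penalty (p0, m0, t0) < 2 * \<eta>"
    by (rule order_tendstoD(2)) (use \<eta> in simp)
  then have "\<forall>\<^sub>F n in sequentially. better_far e lam N U n \<subseteq> B1 n \<union> B2 n"
    using eventually_gt_at_top[of 0]
  proof eventually_elim
    case (elim n)
    show ?case
    proof (rule subsetI, rule ccontr)
      fix \<omega> assume \<omega>: "\<omega> \<in> better_far e lam N U n" "\<omega> \<notin> B1 n \<union> B2 n"
      then obtain q m t where \<theta>: "(q, m, t) \<in> Theta" "compactify (q, m, t) \<in> U"
        and better: "pen_log_lik (\<lambda>i. X i \<omega>) n (lam n) (p0, m0, t0) \<le> pen_log_lik (\<lambda>i. X i \<omega>) n (lam n) (q, m, t)"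
        by (auto simp: better_far_def)
      have space: "\<omega> \<in> space M" "scattered N n \<omega>" using \<omega>(1) by (auto simp: better_far_def)
      have P: "gauss (m $ j) (t $ j) x \<le> u j r x" if "j \<in> - A" for j x
        using U(3)[OF \<theta>(2)] that by (simp add: P_def compactify_def)
      have q: "q $ j \<le> p $ j + 1 / (real r + 1)" "0 \<le> q $ j" for j
        using U(3)[OF \<theta>(2)] \<theta>(1) by (auto simp: P_def compactify_def Theta_def less_imp_le)
      have tA: "t $ j \<le> - T" if "j \<in> A" for j
        using U(3)[OF \<theta>(2)] that by (simp add: P_def compactify_def)
      have le_F: "(\<Sum>j\<in>- A. q $ j * gauss (m $ j) (t $ j) x) \<le> F r x" for x
        unfolding F_def using q P p
        by (intro sum_mono mult_mono) (auto intro: add_nonneg_nonneg)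
      have B2: "(\<Sum>i<n. g r (X i \<omega>)) \<le> n * (- 2 * \<eta>)"
      proof -
        have "(\<Sum>i<n. g r (X i \<omega>)) \<le> n * ((\<integral>x. f0 x * g r x \<partial>lborel) + \<eta>)"
          using \<omega>(2) space by (simp add: B2_def)
        also have "\<dots> \<le> n * (- 2 * \<eta>)" using r by (intro mult_left_mono) auto
        finally show ?thesis .
      qed
      have B1: "(\<Sum>i<n. ln (1 + gauss (m $ j) (t $ j) (X i \<omega>) / f0 (X i \<omega>)))
          \<le> n * (\<eta> / k) + n * lam n / 2 * (t $ j)\<^sup>2" if "j \<in> A" for j
        using \<omega>(2) space tA[OF that] by (auto simp: B1_def not_less)
      have "(\<Sum>i<n. (ln (mix_density (q, m, t) (X i \<omega>)) - ln (f0 (X i \<omega>))) / 2)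
          \<le> (\<Sum>i<n. g r (X i \<omega>) + (\<Sum>j\<in>A. ln (1 + gauss (m $ j) (t $ j) (X i \<omega>) / f0 (X i \<omega>))))"
        unfolding g_def by (intro sum_mono half_log_ratio_le \<theta>(1) le_F)
      also have "\<dots> = (\<Sum>i<n. g r (X i \<omega>))
          + (\<Sum>j\<in>A. \<Sum>i<n. ln (1 + gauss (m $ j) (t $ j) (X i \<omega>) / f0 (X i \<omega>)))"
        unfolding sum.distrib by (subst sum.swap) (rule refl)
      also have "\<dots> \<le> n * (- 2 * \<eta>) + (\<Sum>j\<in>A. n * (\<eta> / k) + n * lam n / 2 * (t $ j)\<^sup>2)"
        by (intro add_mono B2 sum_mono B1)
      \<comment> \<open>Each narrow component has used half of its own penalty in \<open>t\<close>.
        Nonnegative terms complete this to half of the total penalty of the competitor. Since the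
        left side is half a log-likelihood difference, doubling produces exactly the penalty that is
        subtracted in the criterion.\<close>
      also have "(\<Sum>j\<in>A. n * (\<eta> / k) + n * lam n / 2 * (t $ j)\<^sup>2)
          \<le> (\<Sum>j\<in>UNIV. n * (\<eta> / k) + n * lam n / 2 * ((m $ j)\<^sup>2 + (t $ j)\<^sup>2))"
      proof (rule order_trans[OF sum_mono sum_mono2])
        fix j
        show "n * (\<eta> / k) + n * lam n / 2 * (t $ j)\<^sup>2
            \<le> n * (\<eta> / k) + n * lam n / 2 * ((m $ j)\<^sup>2 + (t $ j)\<^sup>2)"
          using lam(1)[of n] by (intro add_left_mono mult_left_mono) auto
        show "0 \<le> n * (\<eta> / k) + n * lam n / 2 * ((m $ j)\<^sup>2 + (t $ j)\<^sup>2)"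
          using lam(1)[of n] \<eta> k by (intro add_nonneg_nonneg mult_nonneg_nonneg) auto
      qed auto
      also have "\<dots> = n * \<eta> + n * lam n / 2 * penalty (q, m, t)"
      proof -
        have "penalty (q, m, t) = (\<Sum>j\<in>UNIV. (m $ j)\<^sup>2 + (t $ j)\<^sup>2)" by (simp add: penalty_def)
        then show ?thesis
          by (subst sum.distrib) (simp only: sum_distrib_left[symmetric], simp add: k_def)
      qed
      also have "(\<Sum>i<n. (ln (mix_density (q, m, t) (X i \<omega>)) - ln (f0 (X i \<omega>))) / 2)
          = (log_lik (\<lambda>i. X i \<omega>) n (q, m, t) - log_lik (\<lambda>i. X i \<omega>) n (p0, m0, t0)) / 2"
        by (simp add: log_lik_def f0_def sum_subtractf flip: sum_divide_distrib)
      finally have 1: "log_lik (\<lambda>i. X i \<omega>) n (q, m, t) - log_lik (\<lambda>i. X i \<omega>) n (p0, m0, t0)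
          \<le> - 2 * (n * \<eta>) + n * lam n * penalty (q, m, t)"
        by (simp add: field_simps)
      have "n * lam n * penalty (q, m, t) - n * lam n * penalty (p0, m0, t0)
          \<le> log_lik (\<lambda>i. X i \<omega>) n (q, m, t) - log_lik (\<lambda>i. X i \<omega>) n (p0, m0, t0)"
        using better by (simp add: pen_log_lik_def)
      \<comment> \<open>The penalty of the competitor, which may be arbitrarily large, cancels. What
        remains involves only the fixed penalty of the true parameter, and \<open>lam n\<close>
        makes it small.\<close>
      with 1 have "n * (2 * \<eta>) \<le> n * (lam n * penalty (p0, m0, t0))" by (simp add: algebra_simps)
      then show False using elim by simp
    qed
  qed
  then have "asymp_null M (better_far e lam N U)" by (rule asymp_null_mono[OF null])
  then show ?thesis using U by blast
qed

lemma asymp_null_better_far: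
  assumes lam: "\<And>n. lam n > 0" "lam \<longlonglongrightarrow> 0" "filterlim (\<lambda>n. real n * lam n) at_top sequentially"
    and e: "e > 0"
  shows "asymp_null M (better_far e lam N UNIV)"
proof -
  have "\<exists>U. open U \<and> y \<in> U \<and> asymp_null M (better_far e lam N U)" if y: "y \<in> compact_params" for y
  proof -
    obtain p a b where eq: "y = (p, a, b)" by (cases y)
    show ?thesis
    proof (cases "{j. \<bar>a $ j\<bar> < 1 \<and> \<bar>b $ j\<bar> < 1} = UNIV \<and> (\<exists>\<tau>. \<tau> permutes UNIV \<and>
        perm_act \<tau> (p0, m0, t0) = (p, (\<chi> j. artanh (a $ j)), (\<chi> j. artanh (b $ j))))")
      case True
      then obtain \<tau> where \<tau>: "\<tau> permutes UNIV"
        "perm_act \<tau> (p0, m0, t0) = (p, (\<chi> j. artanh (a $ j)), (\<chi> j. artanh (b $ j)))"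
        and ab: "\<And>j. \<bar>a $ j\<bar> < 1" "\<And>j. \<bar>b $ j\<bar> < 1" by blast
      obtain U where U: "open U" "(p, a, b) \<in> U" "\<And>\<theta>. compactify \<theta> \<in> U \<Longrightarrow> orbit_dist \<theta> (p0, m0, t0) \<le> e"
        using orbit_neighbourhood[OF ab \<tau> e] by blast
      \<comment> \<open>Near an orbit point there is nothing to estimate: all parameters there are
        within \<open>e\<close> of the orbit, so none qualifies.\<close>
      then have "better_far e lam N U = (\<lambda>_. {})"
        by (auto simp: better_far_def fun_eq_iff not_less[symmetric])
      then show ?thesis using U asymp_null_empty eq by metis
    next
      case False
      show ?thesis unfolding eq by (rule better_far_away[OF lam y[unfolded eq] False])
    qed
  qed
  then obtain U where U: "\<And>y. y \<in> compact_params \<Longrightarrow> open (U y) \<and> y \<in> U y \<and> asymp_null M (better_far e lam N (U y))"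
    by metis
  obtain D where D: "D \<subseteq> compact_params" "finite D" "compact_params \<subseteq> (\<Union>y\<in>D. U y)"
    by (rule compactE_image[OF compact_compact_params, of compact_params U]) (use U in auto)
  have "asymp_null M (\<lambda>n. \<Union>y\<in>D. better_far e lam N (U y) n)"
    using D U by (intro asymp_null_UN) auto
  then show ?thesis
  proof (rule asymp_null_mono, intro always_eventually allI subsetI)
    fix n \<omega> assume "\<omega> \<in> better_far e lam N UNIV n"
    then obtain \<theta> where \<theta>: "\<theta> \<in> Theta" "\<omega> \<in> space M" "scattered N n \<omega>" "e < orbit_dist \<theta> (p0, m0, t0)"
       "pen_log_lik (\<lambda>i. X i \<omega>) n (lam n) (p0, m0, t0) \<le> pen_log_lik (\<lambda>i. X i \<omega>) n (lam n) \<theta>"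
      by (auto simp: better_far_def)
    obtain y where "y \<in> D" "compactify \<theta> \<in> U y"
      using D(3) compactify_in[OF \<theta>(1)] by blast
    then show "\<omega> \<in> (\<Union>y\<in>D. better_far e lam N (U y) n)"
      using \<theta> by (auto simp: better_far_def)
  qed
qed

text \<open>Every maximizer is at least as good as the true parameter, so a distance above
  \<open>e\<close> puts the sample in \<open>better_far\<close> unless it is not scattered. The
  scale \<open>N\<close> depends on the tolerance \<delta>, half of which pays for samples that are
  not scattered, uniformly in n; hence \<open>asymp_null\<close> is verified separately for each
  \<delta>.\<close>

lemma argmax_consistent:
  assumes lam: "\<And>n. lam n > 0" "lam \<longlonglongrightarrow> 0" "filterlim (\<lambda>n. real n * lam n) at_top sequentially"
  shows "tendsto_zero_in_prob M (\<lambda>n \<omega>. hausdorff_dist orbit_dist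
      (pen_argmax (\<lambda>i. X i \<omega>) n (lam n)) (orbit_of (p0, m0, t0)))"
  unfolding tendsto_zero_in_prob_def
proof (intro conjI allI impI)
  define Y where "Y = (\<lambda>n \<omega>. hausdorff_dist orbit_dist
      (pen_argmax (\<lambda>i. X i \<omega>) n (lam n)) (orbit_of (p0, m0, t0)))"
  have meas: "Y n \<in> borel_measurable M" for n
    unfolding Y_def by (rule hausdorff_argmax_measurable[OF X_measurable lam(1)])
  then show "(\<lambda>\<omega>. hausdorff_dist orbit_dist (pen_argmax (\<lambda>i. X i \<omega>) n (lam n)) (orbit_of (p0, m0, t0)))
      \<in> borel_measurable M" for n by (simp add: Y_def)
  fix e :: real assume e: "e > 0"
  have sub: "{\<omega> \<in> space M. Y n \<omega> > ennreal e} \<subseteq> {\<omega> \<in> space M. \<not> scattered N n \<omega>} \<union> better_far e lam N UNIV n" for n N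
  proof
    fix \<omega> assume \<omega>: "\<omega> \<in> {\<omega> \<in> space M. Y n \<omega> > ennreal e}"
    have "pen_argmax (\<lambda>i. X i \<omega>) n (lam n) \<noteq> ({} :: 'k param set)"
      using pen_log_lik_arg_max_exists[OF lam(1)] by (auto simp: pen_argmax_def)
    then have "Y n \<omega> = (SUP \<theta>\<in>pen_argmax (\<lambda>i. X i \<omega>) n (lam n). ennreal (orbit_dist \<theta> (p0, m0, t0)))"
      unfolding Y_def by (rule hausdorff_dist_orbit)
    then have "ennreal e < (SUP \<theta>\<in>pen_argmax (\<lambda>i. X i \<omega>) n (lam n). ennreal (orbit_dist \<theta> (p0, m0, t0)))"
      using \<omega> by simp
    then obtain \<theta> where \<theta>: "\<theta> \<in> pen_argmax (\<lambda>i. X i \<omega>) n (lam n)" "e < orbit_dist \<theta> (p0, m0, t0)"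
      unfolding SUP_ennreal_gt_iff[OF less_imp_le[OF e]] by blast
    have "pen_log_lik (\<lambda>i. X i \<omega>) n (lam n) (p0, m0, t0) \<le> pen_log_lik (\<lambda>i. X i \<omega>) n (lam n) \<theta>" "\<theta> \<in> Theta"
      using \<theta>(1) theta0 by (auto simp: pen_argmax_def is_arg_max_def not_less)
    then show "\<omega> \<in> {\<omega> \<in> space M. \<not> scattered N n \<omega>} \<union> better_far e lam N UNIV n"
      using \<omega> \<theta>(2) by (auto simp: better_far_def)
  qed
  have "asymp_null M (\<lambda>n. {\<omega> \<in> space M. Y n \<omega> > ennreal e})"
    unfolding asymp_null_def
  proof (intro allI impI)
    fix \<delta> :: real assume \<delta>: "\<delta> > 0"
    then obtain N where N: "\<And>n. {\<omega> \<in> space M. \<not> scattered N n \<omega>} \<in> events"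
        "\<And>n. prob {\<omega> \<in> space M. \<not> scattered N n \<omega>} \<le> \<delta> / 2"
      using prob_not_scattered[of "\<delta> / 2"] by auto
    have "\<forall>\<^sub>F n in sequentially. \<exists>E\<in>events. prob E \<le> \<delta> / 2 \<and> better_far e lam N UNIV n \<subseteq> E"
      using \<delta> by (intro asymp_nullD[OF asymp_null_better_far[OF lam e]]) simp
    then show "\<forall>\<^sub>F n in sequentially. \<exists>E\<in>events. prob E \<le> \<delta> \<and> {\<omega> \<in> space M. Y n \<omega> > ennreal e} \<subseteq> E"
    proof eventually_elim
      case (elim n)
      then obtain E where E: "E \<in> events" "prob E \<le> \<delta> / 2" "better_far e lam N UNIV n \<subseteq> E" by blast
      define E' where "E' = {\<omega> \<in> space M. \<not> scattered N n \<omega>}"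
      have "prob (E' \<union> E) \<le> prob E' + prob E"
        using E N(1) unfolding E'_def by (intro measure_Un_le) auto
      also have "\<dots> \<le> \<delta>" using E(2) N(2)[of n] unfolding E'_def by simp
      finally have "prob (E' \<union> E) \<le> \<delta>" .
      moreover have "{\<omega> \<in> space M. Y n \<omega> > ennreal e} \<subseteq> E' \<union> E"
        using sub[of n N] E(3) unfolding E'_def by blast
      moreover have "E' \<union> E \<in> events" using E(1) N(1) unfolding E'_def by auto
      ultimately show ?case by blast
    qed
  qed
  then have "(\<lambda>n. prob {\<omega> \<in> space M. Y n \<omega> > ennreal e}) \<longlonglongrightarrow> 0"
    by (rule asymp_null_imp_tendsto_0) (use meas in measurable)
  then show "(\<lambda>n. prob {\<omega> \<in> space M. ennreal e < hausdorff_dist orbit_dist (pen_argmax (\<lambda>i. X i \<omega>) n (lam n))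
      (orbit_of (p0, m0, t0))}) \<longlonglongrightarrow> 0" by (simp add: Y_def)
qed

end

theorem theorem4p12:
  fixes M :: "'a measure"
    and X :: "nat \<Rightarrow> 'a \<Rightarrow> real"
    and p0 \<mu>0 t0 :: "real ^ 'k::finite"
  assumes k: "CARD('k) \<ge> 2"
    and theta0: "(p0, \<mu>0, t0) \<in> Theta"
    and pos: "(MIN j. p0 $ j) > 0"
    and distinct_comps: "\<And>j l. j \<noteq> l \<Longrightarrow> (\<mu>0 $ j, t0 $ j) \<noteq> (\<mu>0 $ l, t0 $ l)"
    and M: "prob_space M"
    and indep: "prob_space.indep_vars M (\<lambda>_. borel) X UNIV"
    and ident: "\<And>i. distributed M lborel (X i) (\<lambda>x. ennreal (mix_density (p0, \<mu>0, t0) x))"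
  shows "(\<forall>\<omega>\<in>space M. \<forall>n. \<forall>lam>0.
            \<exists>\<theta> :: 'k param. is_arg_max (pen_log_lik (\<lambda>i. X i \<omega>) n lam) (\<lambda>\<theta>. \<theta> \<in> Theta) \<theta>)
       \<and> (\<forall>lam :: nat \<Rightarrow> real.
            (\<forall>n. lam n > 0) \<and> decseq lam \<and> lam \<longlonglongrightarrow> 0 \<and>
            filterlim (\<lambda>n. real n * lam n) at_top sequentially \<longrightarrow>
            tendsto_zero_in_prob M
              (\<lambda>n \<omega>. hausdorff_dist orbit_dist
                       (pen_argmax (\<lambda>i. X i \<omega>) n (lam n)) (orbit_of (p0, \<mu>0, t0))))"
proof (intro conjI ballI allI impI)
  fix \<omega> n and lam :: real
  assume "lam > 0"
  then show "\<exists>\<theta> :: 'k param. is_arg_max (pen_log_lik (\<lambda>i. X i \<omega>) n lam) (\<lambda>\<theta>. \<theta> \<in> Theta) \<theta>"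
    by (rule pen_log_lik_arg_max_exists)
next
  fix lam :: "nat \<Rightarrow> real"
  assume lam: "(\<forall>n. lam n > 0) \<and> decseq lam \<and> lam \<longlonglongrightarrow> 0 \<and>
    filterlim (\<lambda>n. real n * lam n) at_top sequentially"
  interpret prob_space M by (rule M)
  have "p0 $ j > 0" for j
    using pos Min_le[of "range (\<lambda>j. p0 $ j)" "p0 $ j"] by auto
  then interpret gaussian_mixture p0 \<mu>0 t0
    by unfold_locales (use theta0 distinct_comps in auto)
  interpret gaussian_mixture_sample p0 \<mu>0 t0 M X
    by unfold_locales (use indep ident in \<open>simp_all add: f0_def\<close>)
  show "tendsto_zero_in_prob M (\<lambda>n \<omega>. hausdorff_dist orbit_dist
      (pen_argmax (\<lambda>i. X i \<omega>) n (lam n)) (orbit_of (p0, \<mu>0, t0)))"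
    by (rule argmax_consistent) (use lam in auto)
qed

end
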